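(* For all $\varepsilon>0$, there are sets $S, A\subseteq \mathbb Z$ such that $S$ is dense in the Bohr topology of $\mathbb Z$, $d^*(A)>\frac{1}{2}-\varepsilon$, and $(A-A)\cap S=\varnothing$.
   Context: $\mathbb T=\mathbb R/\mathbb Z$ with the quotient topology. The Bohr topology of $\mathbb Z$ is the weakest topology on $\mathbb Z$ making all homomorphisms from $\mathbb Z$ into $\mathbb T$ continuous. For $A\subseteq\mathbb Z$, the difference set is $A-A:=\{a-b: a,b\in A\}$, and the upper Banach density of $A$ is $d^*(A):=\limsup_{n\to\infty}\sup_{k\in\mathbb Z}\frac{|A\cap\{k+1,\dots,k+n\}|}{n}$. *)

theory Defs
  imports "HOL-Analysis.Analysis"
begin

definition circle_rel :: "real \<Rightarrow> real \<Rightarrow> bool" where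
  "circle_rel x y \<longleftrightarrow> x - y \<in> \<int>"

lemma equivp_circle_rel: "equivp circle_rel"
proof (rule equivpI)
  show "reflp circle_rel"
    by (simp add: reflp_def circle_rel_def)
  show "symp circle_rel"
    unfolding symp_def circle_rel_def by (metis Ints_minus minus_diff_eq)
  show "transp circle_rel"
    unfolding transp_def circle_rel_def
    by (metis Ints_add diff_add_cancel add_diff_eq)
qed

text \<open>The group \<open>\<real>/\<int>\<close>, with the quotient topology (see \<open>quotient_map_to_circle\<close> below).\<close>

quotient_type circle = real / circle_rel
  morphisms rep_circle to_circle
  by (rule equivp_circle_rel)

instantiation circle :: ab_group_add
begin

lift_definition zero_circle :: circle is 0 .

lift_definition plus_circle :: "circle \<Rightarrow> circle \<Rightarrow> circle" is "(+)"
  unfolding circle_rel_def by (metis Ints_add add_diff_add)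

lift_definition uminus_circle :: "circle \<Rightarrow> circle" is uminus
  unfolding circle_rel_def by (metis Ints_minus minus_diff_minus)

lift_definition minus_circle :: "circle \<Rightarrow> circle \<Rightarrow> circle" is "(-)"
  unfolding circle_rel_def by (metis Ints_diff diff_diff_add diff_diff_eq2 diff_add_eq add.commute)

instance
  by standard (transfer; simp add: circle_rel_def)+

end

instantiation circle :: topological_space
begin

definition open_circle :: "circle set \<Rightarrow> bool" where
  "open_circle U \<longleftrightarrow> open (to_circle -` U)"

instance
  by standard (auto simp: open_circle_def vimage_Union)

end

lemma quotient_map_to_circle: "quotient_map euclidean euclidean to_circle"
proof -
  have "surj to_circle"
    by (metis Quotient_circle Quotient_abs_rep surjI)
  then show ?thesis
    by (simp add: quotient_map_def open_circle_def vimage_def)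
qed

definition bohr_topology :: "int topology" where
  "bohr_topology =
     topology_generated_by {f -` U | f U. Modules.additive (f :: int \<Rightarrow> circle) \<and> open U}"

lemma topspace_bohr_topology [simp]: "topspace bohr_topology = UNIV"
proof -
  have "Modules.additive (\<lambda>_::int. 0 :: circle)"
    by unfold_locales simp
  then have "(\<lambda>_::int. 0 :: circle) -` UNIV
      \<in> {f -` U | f U. Modules.additive (f :: int \<Rightarrow> circle) \<and> open U}"
    by blast
  then show ?thesis
    unfolding bohr_topology_def topology_generated_by_topspace by auto
qed

lemma continuous_map_bohr_topology:
  assumes "Modules.additive (f :: int \<Rightarrow> circle)"
  shows "continuous_map bohr_topology euclidean f"
proof -
  have "openin bohr_topology (f -` U)" if "open U" for U
    unfolding bohr_topology_def
    by (rule topology_generated_by_Basis) (use assms that in blast)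
  then show ?thesis
    by (simp add: continuous_map_def vimage_def)
qed

lemma bohr_topology_weakest:
  assumes top: "topspace X = UNIV"
    and cont: "\<And>f :: int \<Rightarrow> circle. Modules.additive f \<Longrightarrow> continuous_map X euclidean f"
    and W: "openin bohr_topology W"
  shows "openin X W"
proof -
  have "generate_topology_on
      {f -` U | f U. Modules.additive (f :: int \<Rightarrow> circle) \<and> open U} W"
    using W unfolding bohr_topology_def by (rule openin_topology_generated_by)
  then show ?thesis
  proof induction
    case (Basis V)
    then obtain f :: "int \<Rightarrow> circle" and U
      where "V = f -` U" "Modules.additive f" "open U"
      by blast
    then show ?case
      using cont[of f] top by (simp add: continuous_map_def vimage_def)
  qed auto
qed

definition difference_set :: "int set \<Rightarrow> int set" where
  "difference_set A = {a - b | a b. a \<in> A \<and> b \<in> A}"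

definition upper_banach_density :: "int set \<Rightarrow> ereal" where
  "upper_banach_density A =
     limsup (\<lambda>n. SUP k::int. ereal (real (card (A \<inter> {k + 1..k + int n})) / real n))"

end

theory Submission
  imports Defs "HOL-Probability.Probability"
begin

text \<open>
  Write $e(x) = \exp(2\pi i x)$. The set $A$ consists of those $x$ for which a Gaussian
  trigonometric sum $G(x) = \mathrm{Re} \sum_{j<d} e(x\alpha_j)\xi_j$, with independent complex
  Gaussian coefficients $\xi_j$, exceeds $\delta\sqrt d$; for each $x$ this happens with probability
  close to $1/2$. If $e(s\alpha_j)$ is close to $-1$ for all but a few $j$, then $G(x+s)$ is close
  to $-G(x)$, so $s \notin A - A$.

  If $1, \alpha_0, \dots, \alpha_{d-1}$ are linearly independent over the rationals, then after
  discarding at most $r$ of the $\alpha_j$ the others stay independent of any $r$ prescribed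
  frequencies $\beta_i$. By Kronecker's theorem and compactness there is thus a finite set $S_r$ of
  $s$ with at most $r$ exceptional indices $j$ that meets every rank-$r$ Bohr neighbourhood of
  prescribed size around every small integer.

  To handle all $r$ at once, $\alpha_i$ for $d_m \le i < d_{m+1}$ is chosen so close to
  $\alpha_{i \bmod d_m}$ that elements of $S_0, \dots, S_m$ cannot distinguish the two. An exceptional
  index for $s \in S_l$ then becomes a whole residue class modulo $d_l$, but such a class contributes
  only about $\sqrt{d/d_l}$ to $G$, and $d_l$ is huge compared with $l$.
\<close>

section \<open>Kronecker approximation relative to given frequencies\<close>

text \<open>Closeness to 0 in the circle, expressed through a real representative, so that the
  estimates never have to pass to the quotient.\<close>

definition near_int :: "real \<Rightarrow> real \<Rightarrow> bool" where
  "near_int \<delta> x \<longleftrightarrow> (\<exists>k::int. \<bar>x - of_int k\<bar> < \<delta>)"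

lemma near_int_mono: "near_int a x \<Longrightarrow> a \<le> b \<Longrightarrow> near_int b x"
  unfolding near_int_def by (meson less_le_trans)

lemma near_int_shift: "near_int \<delta> (x + of_int m) \<longleftrightarrow> near_int \<delta> x"
proof -
  have "near_int \<delta> (x + of_int m)" if "near_int \<delta> x" for x m
    using that unfolding near_int_def
    by (metis add_diff_cancel_right of_int_add)
  from this[of x m] this[of "x + of_int m" "-m"] show ?thesis by auto
qed

text \<open>The reals as a rational vector space make the exchange and extension theorems available
  for independence of frequencies.\<close>

interpretation rat_real: vector_space "\<lambda>(q::rat) (x::real). of_rat q * x"
  by unfold_locales (simp_all add: algebra_simps of_rat_add of_rat_mult)

text \<open>Nonzero integer multiples of rationally independent numbers stay independent, so
  Kronecker's theorem applies to the products \<open>w c * c\<close>. The weights later absorb a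
  common denominator that has to be paid at some of the frequencies only.\<close>

lemma kronecker_scaled:
  fixes C :: "real set" and w :: "real \<Rightarrow> int" and y :: "real \<Rightarrow> real"
  assumes fin: "finite C" and C: "rat_real.independent C" "1 \<in> C"
    and w: "\<And>c. c \<in> C \<Longrightarrow> w c \<noteq> 0" and w1: "w 1 = 1" and "\<epsilon> > 0"
  shows "\<exists>n::int. \<forall>c\<in>C - {1}. near_int \<epsilon> (of_int n * (of_int (w c) * c) - y c)"
proof -
  define N where "N = card (C - {1})"
  obtain f where f: "bij_betw f {..<N} (C - {1})"
    using ex_bij_betw_nat_finite[of "C - {1}"] fin
    by (metis N_def finite_Diff atLeast0LessThan)
  \<comment> \<open>The member 1 gets the last index N: \<open>Kronecker_thm_2\<close> expects the
    value 1 there and prescribes only the values before it.\<close>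
  define g where "g i = (if i = N then 1 else f i)" for i
  have g: "bij_betw g {..N} C"
  proof -
    have "bij_betw g {..<N} (C - {1})"
      using f by (rule bij_betw_cong[THEN iffD1, rotated]) (auto simp: g_def)
    moreover have "{..N} = insert N {..<N}" "C = insert 1 (C - {1})"
      using C by auto
    moreover have "g N = 1" by (simp add: g_def)
    ultimately show ?thesis
      by (metis (no_types, lifting) notIn_Un_bij_betw Diff_iff Un_insert_right insertI1 lessThan_iff less_irrefl sup_bot_right)
  qed
  define \<theta> where "\<theta> i = of_int (w (g i)) * g i" for i
  have gC: "g i \<in> C" if "i \<le> N" for i
    using g that by (auto simp: bij_betw_def)
  have zero: "u i = 0" if u: "(\<Sum>i\<le>N. of_int (u i) * \<theta> i) = 0" and i: "i \<le> N" for u :: "nat \<Rightarrow> int" and i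
  proof -
    define v :: "real \<Rightarrow> rat" where "v c = of_int (u (inv_into {..N} g c) * w c)" for c
    have "(\<Sum>c\<in>C. of_rat (v c) * c) = (\<Sum>i\<le>N. of_rat (v (g i)) * g i)"
      using sum.reindex_bij_betw[OF g, of "\<lambda>c. of_rat (v c) * c"] by simp
    also have "\<dots> = (\<Sum>i\<le>N. of_int (u i) * \<theta> i)"
      using g by (intro sum.cong) (auto simp: v_def \<theta>_def bij_betw_def of_rat_mult)
    finally have "(\<Sum>c\<in>C. of_rat (v c) * c) = 0" using u by simp
    then have "\<forall>c\<in>C. v c = 0"
      using C fin rat_real.dependent_finite by blast
    then have "v (g i) = 0" using gC i by blast
    moreover have "inv_into {..N} g (g i) = i"
      using g i by (auto simp: bij_betw_def)
    ultimately show ?thesis using w[OF gC[OF i]] by (simp add: v_def)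
  qed
  \<comment> \<open>\<open>Kronecker_thm_2\<close> is phrased with integer coefficients, hence a
    second structure on the reals, as a module over the integers.\<close>
  interpret Z: Modules.module "\<lambda>r x. real_of_int r * x"
    by (simp add: Modules.module.intro distrib_left mult.commute)
  have inj: "inj_on \<theta> {..N}"
  proof (rule inj_onI, rule ccontr)
    fix i j assume ij: "i \<in> {..N}" "j \<in> {..N}" "\<theta> i = \<theta> j" "i \<noteq> j"
    \<comment> \<open>Two equal values would satisfy the relation with coefficients 1 and -1, which
      \<open>zero\<close> excludes.\<close>
    define u where "u k = (if k = i then 1 else 0) - (if k = j then 1 else 0 :: int)" for k
    have "(\<Sum>k\<le>N. of_int (u k) * \<theta> k) = (\<Sum>k\<le>N. (if k = i then \<theta> k else 0) - (if k = j then \<theta> k else 0))"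
      by (intro sum.cong) (auto simp: u_def)
    also have "\<dots> = 0" using ij by (simp add: sum_subtractf)
    finally have "u i = 0" using zero ij by blast
    then show False using ij by (simp add: u_def)
  qed
  have "Z.independent (\<theta> ` {..N})"
  proof -
    have False if u: "(\<Sum>v\<in>\<theta> ` {..N}. real_of_int (u v) * v) = 0" "v \<in> \<theta> ` {..N}" "u v \<noteq> 0" for u v
    proof -
      have "(\<Sum>i\<le>N. of_int (u (\<theta> i)) * \<theta> i) = 0"
        using u(1) by (simp add: sum.reindex[OF inj])
      then show False using zero[of "u \<circ> \<theta>"] u by auto
    qed
    then show ?thesis
      by (subst Z.dependent_finite) auto
  qed
  moreover have "\<theta> N = 1" by (simp add: \<theta>_def g_def w1)
  ultimately obtain k m where km: "\<And>i. i < N \<Longrightarrow> \<bar>of_int k * \<theta> i - of_int (m i) - y (g i)\<bar> < \<epsilon>"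
    using Kronecker_thm_2[of \<theta> N \<epsilon> "\<lambda>i. y (g i)"] inj \<open>\<epsilon> > 0\<close> by blast
  have "near_int \<epsilon> (of_int k * (of_int (w c) * c) - y c)" if "c \<in> C - {1}" for c
  proof -
    obtain i where "i < N" "f i = c"
      using f \<open>c \<in> C - {1}\<close> by (metis bij_betw_imp_surj_on imageE lessThan_iff)
    then show ?thesis
      using km[of i] unfolding near_int_def \<theta>_def g_def
      by (intro exI[of _ "m i"]) (auto simp: algebra_simps)
  qed
  then show ?thesis by blast
qed

lemma near_int_sum:
  fixes m :: "'a \<Rightarrow> int" and x :: "'a \<Rightarrow> real"
  assumes "finite I" "\<And>i. i \<in> I \<Longrightarrow> near_int \<epsilon> (x i)" "\<epsilon> > 0" "(\<Sum>i\<in>I. \<bar>real_of_int (m i)\<bar>) * \<epsilon> < \<delta>"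
  shows "near_int \<delta> (\<Sum>i\<in>I. of_int (m i) * x i)"
proof -
  obtain k :: "'a \<Rightarrow> int" where k: "\<And>i. i \<in> I \<Longrightarrow> \<bar>x i - of_int (k i)\<bar> < \<epsilon>"
    using assms(2) unfolding near_int_def by metis
  have "\<bar>(\<Sum>i\<in>I. of_int (m i) * x i) - of_int (\<Sum>i\<in>I. m i * k i)\<bar> = \<bar>\<Sum>i\<in>I. of_int (m i) * (x i - of_int (k i))\<bar>"
    by (simp add: algebra_simps sum_subtractf)
  also have "\<dots> \<le> (\<Sum>i\<in>I. \<bar>real_of_int (m i)\<bar> * \<epsilon>)"
    by (rule order_trans[OF sum_abs], intro sum_mono)
       (auto simp: abs_mult intro!: mult_left_mono less_imp_le[OF k])
  also have "\<dots> < \<delta>" using assms by (simp add: sum_distrib_right)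
  finally show ?thesis unfolding near_int_def by blast
qed

lemma common_denominator:
  fixes q :: "'a \<Rightarrow> rat"
  assumes "finite I"
  shows "\<exists>Q::int. Q > 0 \<and> (\<forall>i\<in>I. of_int Q * q i \<in> \<int>)"
  using assms
proof induction
  case empty show ?case by (intro exI[of _ 1]) auto
next
  case (insert i I)
  then obtain Q where Q: "Q > 0" "\<forall>i\<in>I. of_int Q * q i \<in> \<int>" by blast
  obtain a b where ab: "quotient_of (q i) = (a, b)" by force
  have b: "b > 0" "q i = of_int a / of_int b"
    using quotient_of_denom_pos[OF ab] quotient_of_div[OF ab] by auto
  have "of_int (Q * b) * q i \<in> \<int>" using b by simp
  moreover have "of_int (Q * b) * q j \<in> \<int>" if "j \<in> I" for j
  proof -
    have "of_int (Q * b) * q j = of_int b * (of_int Q * q j)" by simp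
    then show ?thesis using Q(2) that by (metis Ints_mult Ints_of_int)
  qed
  ultimately show ?case using Q(1) b(1) by (intro exI[of _ "Q * b"]) auto
qed

text \<open>Take a basis \<open>B0\<close> of the span of 1 and B, and extend it by members of A to
  a basis C. The members of A that are not new in C form J, and counting dimensions bounds their
  number. On C all values can be prescribed freely: 0 on \<open>B0\<close>, which makes the
  multiples of B small, and y on the rest of A.\<close>

lemma kronecker_relative:
  fixes A B :: "real set"
  assumes A: "finite A" "rat_real.independent (insert 1 A)" "1 \<notin> A" and B: "finite B"
  shows "\<exists>J\<subseteq>A. card J \<le> card B \<and>
    (\<forall>\<epsilon>>0. \<forall>y. \<exists>n::int. (\<forall>b\<in>B. near_int \<epsilon> (of_int n * b)) \<and> (\<forall>a\<in>A - J. near_int \<epsilon> (of_int n * a - y a)))"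
proof -
  have "rat_real.independent {1}" by simp
  then obtain B0 where B0: "{1} \<subseteq> B0" "B0 \<subseteq> insert 1 B" "rat_real.independent B0" "insert 1 B \<subseteq> rat_real.span B0"
    using rat_real.maximal_independent_subset_extend[of "{1}" "insert 1 B"] by blast
  obtain C where C: "B0 \<subseteq> C" "C \<subseteq> B0 \<union> A" "rat_real.independent C" "B0 \<union> A \<subseteq> rat_real.span C"
    using rat_real.maximal_independent_subset_extend[of B0 "B0 \<union> A"] B0(3) by blast
  have finB0: "finite B0" using B0(2) B by (meson finite_insert finite_subset)
  have finC: "finite C" using C(2) finB0 A(1) by (meson finite_UnI finite_subset)
  define J where "J = A - (C - B0)"
  \<comment> \<open>C has at least \<open>card A + 1\<close> elements and \<open>B0\<close> at most
    \<open>card B + 1\<close>, so at most \<open>card B\<close> members of A fail to be new.\<close>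
  have "card (insert 1 A) \<le> card C"
    using rat_real.independent_span_bound[OF finC A(2)] C(4) B0(1) by blast
  then have "card A + 1 \<le> card C" using A by simp
  moreover have "card B0 \<le> card B + 1"
    using B0(2) B by (metis Suc_eq_plus1 card_insert_le_m1 card_mono card_insert_if finite_insert le_SucI order_trans le_refl)
  moreover have "card (C - B0) = card C - card B0"
    using C(1) finB0 by (simp add: card_Diff_subset)
  moreover have "card J = card A - card (C - B0)"
    unfolding J_def using C(2) A(1) finC by (intro card_Diff_subset) auto
  ultimately have cardJ: "card J \<le> card B" by linarith
  have "\<exists>q. b = (\<Sum>c\<in>B0. of_rat (q c) * c)" if "b \<in> B" for b
    using B0(4) that by (auto simp: rat_real.span_finite[OF finB0])
  then obtain q where q: "\<And>b. b \<in> B \<Longrightarrow> b = (\<Sum>c\<in>B0. of_rat (q b c) * c)" by metis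
  \<comment> \<open>For every b in B, Q * b is an integer combination of \<open>B0\<close>, with
    coefficients \<open>m b c\<close>.\<close>
  obtain Q :: int where Q: "Q > 0" "\<forall>p\<in>B \<times> B0. of_int Q * (case p of (b, c) \<Rightarrow> q b c) \<in> \<int>"
    using common_denominator[of "B \<times> B0" "\<lambda>(b, c). q b c"] B finB0 by blast
  then have "\<exists>m::int. of_int Q * q b c = of_int m" if "b \<in> B" "c \<in> B0" for b c
    using that by (force elim: Ints_cases)
  then obtain m :: "real \<Rightarrow> real \<Rightarrow> int" where m: "\<And>b c. b \<in> B \<Longrightarrow> c \<in> B0 \<Longrightarrow> of_int Q * q b c = of_int (m b c)"
    by metis
  have "\<exists>n::int. (\<forall>b\<in>B. near_int \<epsilon> (of_int n * b)) \<and> (\<forall>a\<in>A - J. near_int \<epsilon> (of_int n * a - y a))"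
    if "\<epsilon> > 0" for \<epsilon> y
  proof -
    \<comment> \<open>Small enough that the errors at \<open>B0\<close>, weighted by the
      coefficients of any Q * b, add up to less than \<epsilon>; the summand 1 keeps the denominator
      positive.\<close>
    define \<epsilon>' where "\<epsilon>' = \<epsilon> / (1 + (\<Sum>b\<in>B. \<Sum>c\<in>B0. \<bar>real_of_int (m b c)\<bar>))"
    have pos: "(\<Sum>b\<in>B. \<Sum>c\<in>B0. \<bar>real_of_int (m b c)\<bar>) \<ge> 0" by (intro sum_nonneg) auto
    have \<epsilon>': "\<epsilon>' > 0" "\<epsilon>' \<le> \<epsilon>"
      using that pos by (auto simp: \<epsilon>'_def field_simps)
    define y' where "y' c = (if c \<in> B0 then 0 else y c)" for c
    \<comment> \<open>The integer sought is Q * n. On \<open>B0\<close> it suffices to control n *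
      c, since the factor Q is used up in clearing denominators; on the other frequencies Q * n * c
      itself is steered to y.\<close>
    define w where "w c = (if c \<in> B0 then 1 else Q)" for c
    have "1 \<in> C" "w 1 = 1" "w c \<noteq> 0" for c
      using B0(1) C(1) Q(1) by (auto simp: w_def)
    then obtain n :: int where n: "\<forall>c\<in>C - {1}. near_int \<epsilon>' (of_int n * (of_int (w c) * c) - y' c)"
      using kronecker_scaled[OF finC C(3), of w \<epsilon>' y'] \<epsilon>'(1) by blast
    have "near_int \<epsilon> (of_int (Q * n) * b)" if "b \<in> B" for b
    proof -
      have "of_int (Q * n) * b = (\<Sum>c\<in>B0. of_int Q * of_int n * (of_rat (q b c) * c))"
        by (subst q[OF that]) (simp add: sum_distrib_left)
      also have "\<dots> = (\<Sum>c\<in>B0. of_int (m b c) * (of_int n * c))"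
      proof (rule sum.cong[OF refl])
        fix c assume "c \<in> B0"
        have "real_of_int Q * of_rat (q b c) = of_rat (of_int Q * q b c)"
          by (simp add: of_rat_mult)
        also have "\<dots> = of_int (m b c)" using m[OF \<open>b \<in> B\<close> \<open>c \<in> B0\<close>] by simp
        finally show "of_int Q * of_int n * (of_rat (q b c) * c) = of_int (m b c) * (of_int n * c)"
          by (metis mult.assoc mult.commute)
      qed
      also have "near_int \<epsilon> \<dots>"
      proof (rule near_int_sum[OF finB0 _ \<epsilon>'(1)])
        show "near_int \<epsilon>' (of_int n * c)" if "c \<in> B0" for c
        proof (cases "c = 1")
          case True
          then show ?thesis using \<epsilon>' by (auto simp: near_int_def intro!: exI[of _ n])
        next
          case False
          then show ?thesis using n that C(1) by (force simp: w_def y'_def)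
        qed
        have "(\<Sum>c\<in>B0. \<bar>real_of_int (m b c)\<bar>) \<le> (\<Sum>b\<in>B. \<Sum>c\<in>B0. \<bar>real_of_int (m b c)\<bar>)"
          using that B by (intro member_le_sum) (auto intro: sum_nonneg)
        then have "(\<Sum>c\<in>B0. \<bar>real_of_int (m b c)\<bar>) < 1 + (\<Sum>b\<in>B. \<Sum>c\<in>B0. \<bar>real_of_int (m b c)\<bar>)"
          by linarith
        then show "(\<Sum>c\<in>B0. \<bar>real_of_int (m b c)\<bar>) * \<epsilon>' < \<epsilon>"
          using \<open>\<epsilon> > 0\<close> pos by (simp add: \<epsilon>'_def pos_divide_less_eq)
      qed
      finally show ?thesis .
    qed
    moreover have "near_int \<epsilon> (of_int (Q * n) * a - y a)" if "a \<in> A - J" for a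
    proof -
      have a: "a \<in> C - {1}" "a \<notin> B0" using that A(3) by (auto simp: J_def)
      then have "near_int \<epsilon>' (of_int n * (of_int (w a) * a) - y' a)" using n by blast
      then have "near_int \<epsilon>' (of_int (Q * n) * a - y a)"
        using a by (simp add: w_def y'_def mult_ac)
      then show ?thesis using \<epsilon>'(2) near_int_mono by blast
    qed
    ultimately show ?thesis by blast
  qed
  then show ?thesis
    by (intro exI[of _ J]) (use cardJ in \<open>auto simp: J_def\<close>)
qed

section \<open>Bohr neighbourhoods\<close>

text \<open>A homomorphism is determined by its value at 1, and \<beta> is a real representative of
  that value.\<close>

lemma additive_int_circle:
  fixes f :: "int \<Rightarrow> circle"
  assumes "Modules.additive f"
  obtains \<beta> where "\<And>n. f n = to_circle (of_int n * \<beta>)"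
proof -
  interpret f: Modules.additive f by (rule assms)
  define \<beta> where "\<beta> = rep_circle (f 1)"
  have add: "to_circle (x + y) = to_circle x + to_circle y" for x y
    by (simp add: plus_circle.abs_eq)
  have minus: "to_circle (x - y) = to_circle x - to_circle y" for x y
    by (simp add: minus_circle.abs_eq)
  have 1: "to_circle \<beta> = f 1"
    unfolding \<beta>_def by (metis Quotient_circle Quotient_abs_rep)
  have "f n = to_circle (of_int n * \<beta>)" for n
  proof (induction n rule: int_induct[where k = 0])
    case base
    then show ?case by (simp add: f.zero zero_circle.abs_eq)
  next
    case (step1 i)
    then show ?case by (simp add: f.add algebra_simps add 1)
  next
    case (step2 i)
    then show ?case by (simp add: f.diff algebra_simps minus 1)
  qed
  then show ?thesis using that by blast
qed

text \<open>Induction over the generation of the topology. A subbasic set yields one frequency and a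
  radius from openness of the preimage in the reals; an intersection takes the union of the
  frequency sets and the smaller radius.\<close>

lemma bohr_neighbourhood:
  assumes "openin bohr_topology W" "t \<in> W"
  shows "\<exists>B \<delta>. finite B \<and> \<delta> > 0 \<and> (\<forall>n. (\<forall>b\<in>B. near_int \<delta> (of_int (n - t) * b)) \<longrightarrow> n \<in> W)"
proof -
  have "generate_topology_on {f -` U | f U. Modules.additive (f :: int \<Rightarrow> circle) \<and> open U} W"
    using assms(1) unfolding bohr_topology_def by (rule openin_topology_generated_by)
  then show ?thesis using assms(2)
  proof induction
    case Empty
    then show ?case by simp
  next
    case (Int a b)
    obtain B1 \<delta>1 where 1: "finite B1" "\<delta>1 > 0"
        "\<And>n. (\<forall>b\<in>B1. near_int \<delta>1 (of_int (n - t) * b)) \<Longrightarrow> n \<in> a"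
      using Int.IH(1) Int.prems by blast
    obtain B2 \<delta>2 where 2: "finite B2" "\<delta>2 > 0"
        "\<And>n. (\<forall>b\<in>B2. near_int \<delta>2 (of_int (n - t) * b)) \<Longrightarrow> n \<in> b"
      using Int.IH(2) Int.prems by blast
    have "n \<in> a \<inter> b" if "\<forall>c\<in>B1 \<union> B2. near_int (min \<delta>1 \<delta>2) (of_int (n - t) * c)" for n
    proof
      show "n \<in> a" by (intro 1(3) ballI near_int_mono[OF bspec[OF that]]) auto
      show "n \<in> b" by (intro 2(3) ballI near_int_mono[OF bspec[OF that]]) auto
    qed
    moreover have "finite (B1 \<union> B2)" "min \<delta>1 \<delta>2 > 0" using 1 2 by auto
    ultimately show ?case by blast
  next
    case (UN K)
    then obtain k where "k \<in> K" "t \<in> k" by blast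
    then obtain B \<delta> where "finite B" "\<delta> > 0" "\<forall>n. (\<forall>b\<in>B. near_int \<delta> (of_int (n - t) * b)) \<longrightarrow> n \<in> k"
      using UN.IH by blast
    with \<open>k \<in> K\<close> show ?case by (intro exI[of _ B] exI[of _ \<delta>]) auto
  next
    case (Basis V)
    then obtain f :: "int \<Rightarrow> circle" and U
      where V: "V = f -` U" "Modules.additive f" "open U" by blast
    obtain \<beta> where \<beta>: "\<And>n. f n = to_circle (of_int n * \<beta>)"
      using additive_int_circle[OF V(2)] by blast
    have "open (to_circle -` U)" using V(3) by (simp add: open_circle_def)
    moreover have "of_int t * \<beta> \<in> to_circle -` U"
      using Basis(2) V(1) \<beta> by simp
    ultimately obtain \<delta> where \<delta>: "\<delta> > 0" "\<And>x. \<bar>x - of_int t * \<beta>\<bar> < \<delta> \<Longrightarrow> to_circle x \<in> U"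
      unfolding open_dist dist_real_def by auto
    have "n \<in> V" if near: "near_int \<delta> (of_int (n - t) * \<beta>)" for n
    proof -
      obtain k where k: "\<bar>of_int (n - t) * \<beta> - of_int k\<bar> < \<delta>"
        using near by (auto simp: near_int_def)
      then have "to_circle (of_int n * \<beta> - of_int k) \<in> U"
        by (intro \<delta>(2)) (simp add: algebra_simps)
      moreover have "to_circle (of_int n * \<beta> - of_int k) = to_circle (of_int n * \<beta>)"
        by (simp add: circle.abs_eq_iff circle_rel_def)
      ultimately show ?thesis by (simp add: V(1) \<beta>)
    qed
    then show ?case using \<delta>(1) by (intro exI[of _ "{\<beta>}"] exI[of _ \<delta>]) auto
  qed
qed

section \<open>The frequencies and the set \<open>S\<close>\<close>

text \<open>Independence of a set does not see repetitions, so injectivity and the absence of the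
  value 1 are demanded separately.\<close>

definition rat_indep :: "(nat \<Rightarrow> real) \<Rightarrow> nat \<Rightarrow> bool" where
  "rat_indep \<alpha> n \<longleftrightarrow> inj_on \<alpha> {..<n} \<and> 1 \<notin> \<alpha> ` {..<n} \<and> rat_real.independent (insert 1 (\<alpha> ` {..<n}))"

lemma countable_rat_span: "finite B \<Longrightarrow> countable (rat_real.span B)"
proof (induction B rule: finite_induct)
  case (insert b B)
  have "rat_real.span (insert b B) \<subseteq> (\<lambda>(q, x). of_rat q * b + x) ` (UNIV \<times> rat_real.span B)"
  proof
    fix x assume "x \<in> rat_real.span (insert b B)"
    then obtain q where "x - of_rat q * b \<in> rat_real.span B"
      by (auto simp: rat_real.span_insert)
    then show "x \<in> (\<lambda>(q, x). of_rat q * b + x) ` (UNIV \<times> rat_real.span B)"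
      by (intro image_eqI[of _ _ "(q, x - of_rat q * b)"]) auto
  qed
  moreover have "countable ((\<lambda>(q, x). of_rat q * b + x) ` ((UNIV :: rat set) \<times> rat_real.span B))"
    using insert.IH by auto
  ultimately show ?case by (rule countable_subset)
qed simp

text \<open>The new values are chosen one by one. The rational span of 1 and the earlier values is
  countable, so it cannot cover the interval of radius \<tau> around \<open>g i\<close>.\<close>

lemma rat_indep_extend:
  fixes \<alpha> g :: "nat \<Rightarrow> real"
  assumes "rat_indep \<alpha> n" "n \<le> n'" "\<tau> > 0"
  shows "\<exists>\<alpha>'. (\<forall>i<n. \<alpha>' i = \<alpha> i) \<and> rat_indep \<alpha>' n' \<and> (\<forall>i. n \<le> i \<and> i < n' \<longrightarrow> \<bar>\<alpha>' i - g i\<bar> < \<tau>)"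
  using assms(2)
proof (induction n' rule: dec_induct)
  case base
  then show ?case using assms(1) by (intro exI[of _ \<alpha>]) auto
next
  case (step m)
  then obtain \<alpha>' where \<alpha>': "\<forall>i<n. \<alpha>' i = \<alpha> i" "rat_indep \<alpha>' m" "\<forall>i. n \<le> i \<and> i < m \<longrightarrow> \<bar>\<alpha>' i - g i\<bar> < \<tau>"
    by blast
  have "countable (rat_real.span (insert 1 (\<alpha>' ` {..<m})))"
    by (intro countable_rat_span) auto
  then have "\<not> {g m - \<tau> <..< g m + \<tau>} \<subseteq> rat_real.span (insert 1 (\<alpha>' ` {..<m}))"
    using uncountable_open_interval[of "g m - \<tau>" "g m + \<tau>"] assms(3) countable_subset by auto
  then obtain x where "x \<in> {g m - \<tau> <..< g m + \<tau>}" and x2: "x \<notin> rat_real.span (insert 1 (\<alpha>' ` {..<m}))"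
    by blast
  then have x1: "\<bar>x - g m\<bar> < \<tau>" by (simp add: abs_less_iff)
  have x': "x \<notin> insert 1 (\<alpha>' ` {..<m})"
    using contra_subsetD[OF rat_real.span_superset x2] .
  define \<alpha>'' where "\<alpha>'' = \<alpha>'(m := x)"
  have img: "\<alpha>'' ` {..<Suc m} = insert x (\<alpha>' ` {..<m})"
    by (auto simp: \<alpha>''_def lessThan_Suc)
  have "inj_on \<alpha>'' {..<Suc m}"
  proof -
    have "inj_on \<alpha>'' {..<m}" using \<alpha>'(2) unfolding rat_indep_def by (auto simp: \<alpha>''_def inj_on_def)
    moreover have "\<alpha>'' ` {..<m} = \<alpha>' ` {..<m}" by (auto simp: \<alpha>''_def)
    ultimately show ?thesis using x' unfolding lessThan_Suc by (simp add: \<alpha>''_def)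
  qed
  moreover have "rat_real.independent (insert 1 (\<alpha>'' ` {..<Suc m}))"
    using \<alpha>'(2) x2 unfolding img rat_indep_def
    by (subst insert_commute) (simp add: rat_real.independent_insertI)
  ultimately have "rat_indep \<alpha>'' (Suc m)"
    using \<alpha>'(2) x' unfolding rat_indep_def by (auto simp: img)
  moreover have "\<forall>i<n. \<alpha>'' i = \<alpha> i" using \<alpha>'(1) step(1) by (auto simp: \<alpha>''_def)
  moreover have "\<forall>i. n \<le> i \<and> i < Suc m \<longrightarrow> \<bar>\<alpha>'' i - g i\<bar> < \<tau>"
    using \<alpha>'(3) x1 by (auto simp: \<alpha>''_def less_Suc_eq)
  ultimately show ?case by blast
qed

lemma rat_indep_irrational:
  assumes "rat_indep \<alpha> n" "i < n"
  shows "\<alpha> i \<notin> \<rat>"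
proof
  assume "\<alpha> i \<in> \<rat>"
  then obtain q where "\<alpha> i = of_rat q" by (auto elim: Rats_cases)
  then have "\<alpha> i \<in> rat_real.span {1}"
    by (metis mult.right_neutral rat_real.span_base rat_real.span_scale singletonI)
  moreover have "1 \<noteq> \<alpha> i" using assms by (auto simp: rat_indep_def)
  then have "{1} \<subseteq> insert 1 (\<alpha> ` {..<n}) - {\<alpha> i}" by auto
  then have "rat_real.span {1} \<subseteq> rat_real.span (insert 1 (\<alpha> ` {..<n}) - {\<alpha> i})"
    by (rule rat_real.span_mono)
  ultimately show False
    using assms unfolding rat_indep_def rat_real.dependent_def by blast
qed

lemma finite_far_from_int:
  assumes "finite I" "\<And>i. i \<in> I \<Longrightarrow> x i \<notin> \<int>"
  shows "\<exists>\<delta>>0. \<forall>i\<in>I. \<not> near_int \<delta> (x i)"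
  using assms
proof (induction I rule: finite_induct)
  case empty show ?case by (intro exI[of _ 1]) auto
next
  case (insert i I)
  then obtain \<delta> where \<delta>: "\<delta> > 0" "\<forall>i\<in>I. \<not> near_int \<delta> (x i)" by auto
  have "closed (\<int> :: real set)" by simp
  from separate_point_closed[OF this insert.prems[OF insertI1]]
  obtain e where e: "e > 0" "\<forall>y\<in>\<int>. e \<le> dist (x i) y" by (elim exE conjE)
  have "\<not> near_int e (x i)"
    unfolding near_int_def using e(2) by (metis Ints_of_int dist_real_def not_le)
  then have "\<forall>j\<in>insert i I. \<not> near_int (min \<delta> e) (x j)"
    using \<delta>(2) near_int_mono[of "min \<delta> e" _ \<delta>] near_int_mono[of "min \<delta> e" _ e] by auto
  then show ?case using \<delta>(1) e(1) by (intro exI[of _ "min \<delta> e"]) simp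
qed

text \<open>\<open>kronecker_relative\<close> gives an integer n that is almost trivial on the
  \<beta> and moves all but l of the \<alpha> to 1/2 - t * \<alpha>; then s = n + t works. For the
  size of s: since the \<alpha> are irrational, multiples by integers up to R keep a positive
  distance from 1/2 modulo 1, so a fine enough approximation at a single index forces s to be
  large.\<close>

lemma stage_pointwise:
  assumes \<alpha>: "rat_indep \<alpha> d" and l: "l < d" and \<eta>: "\<eta> > 0"
  shows "\<exists>s::int. card {i. i < d \<and> \<not> near_int \<eta> (of_int s * \<alpha> i - 1/2)} \<le> l \<and> \<bar>s\<bar> > R \<and>
           (\<forall>i<l. near_int (1 / real (Suc l)) (of_int (s - t) * \<beta> i))"
proof -
  have "\<exists>\<delta>>0. \<forall>p\<in>{..<d} \<times> {-R..R}. \<not> near_int \<delta> (case p of (i, m) \<Rightarrow> of_int m * \<alpha> i - 1/2)"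
  proof (rule finite_far_from_int)
    fix p assume "p \<in> {..<d} \<times> {-R..R}"
    then obtain i m where p: "p = (i, m)" "i < d" by auto
    show "(case p of (i, m) \<Rightarrow> of_int m * \<alpha> i - 1/2) \<notin> \<int>"
    proof
      assume "(case p of (i, m) \<Rightarrow> of_int m * \<alpha> i - 1/2) \<in> \<int>"
      then obtain k where "of_int m * \<alpha> i - 1/2 = of_int k" by (auto simp: p elim!: Ints_cases)
      then have k: "of_int m * \<alpha> i = of_int k + 1/2" by linarith
      have m: "m \<noteq> 0"
      proof
        assume "m = 0"
        \<comment> \<open>An odd integer would vanish. For m nonzero the equation makes \<alpha> i
          rational instead.\<close>
        then have "real_of_int (2 * k + 1) = 0" using k by simp
        then have "2 * k + 1 = 0" by (simp only: of_int_eq_0_iff)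
        then show False by presburger
      qed
      then have "\<alpha> i = (of_int k + 1/2) / of_int m" using k by (simp add: field_simps)
      also have "\<dots> \<in> \<rat>" by simp
      finally show False using rat_indep_irrational[OF \<alpha> p(2)] by blast
    qed
  qed auto
  then obtain \<delta> where \<delta>: "\<delta> > 0" "\<And>i m. i < d \<Longrightarrow> \<bar>m\<bar> \<le> R \<Longrightarrow> \<not> near_int \<delta> (of_int m * \<alpha> i - 1/2)"
    by (auto simp: abs_le_iff) 
  define \<epsilon> where "\<epsilon> = min (min \<delta> \<eta>) (1 / real (Suc l))"
  have \<epsilon>: "\<epsilon> > 0" "\<epsilon> \<le> \<delta>" "\<epsilon> \<le> \<eta>" "\<epsilon> \<le> 1 / real (Suc l)" using \<delta> \<eta> by (auto simp: \<epsilon>_def)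
  have "rat_real.independent (insert 1 (\<alpha> ` {..<d}))" "1 \<notin> \<alpha> ` {..<d}"
    using \<alpha> by (simp_all add: rat_indep_def)
  from kronecker_relative[OF finite_imageI[OF finite_lessThan] this finite_imageI[OF finite_lessThan], of \<beta> l]
  obtain J where J: "J \<subseteq> \<alpha> ` {..<d}" "card J \<le> card (\<beta> ` {..<l})" and
    ex: "\<forall>\<epsilon>>0. \<forall>y. \<exists>n::int. (\<forall>b\<in>\<beta> ` {..<l}. near_int \<epsilon> (of_int n * b)) \<and> (\<forall>a\<in>\<alpha> ` {..<d} - J. near_int \<epsilon> (of_int n * a - y a))"
    by (elim exE conjE)
  have cJ: "card J \<le> l" using J(2) card_image_le[of "{..<l}" \<beta>] by simp
  obtain n :: int where n: "\<forall>b\<in>\<beta> ` {..<l}. near_int \<epsilon> (of_int n * b)"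
     "\<forall>a\<in>\<alpha> ` {..<d} - J. near_int \<epsilon> (of_int n * a - (1/2 - of_int t * a))"
    using ex[rule_format, OF \<epsilon>(1), of "\<lambda>a. 1/2 - of_int t * a"] by (elim exE conjE)
  define s where "s = n + t"
  have s: "near_int \<epsilon> (of_int s * \<alpha> i - 1/2)" if "i < d" "\<alpha> i \<notin> J" for i
    using bspec[OF n(2), of "\<alpha> i"] that by (simp add: s_def algebra_simps)
  have inj: "inj_on \<alpha> {..<d}" using \<alpha> by (simp add: rat_indep_def)
  have bad: "card {i. i < d \<and> \<not> near_int \<epsilon> (of_int s * \<alpha> i - 1/2)} \<le> l"
  proof -
    have "card {i. i < d \<and> \<not> near_int \<epsilon> (of_int s * \<alpha> i - 1/2)} \<le> card J"
      using s inj J(1) by (intro card_inj_on_le[of \<alpha>] finite_subset[OF J(1)]) (auto simp: inj_on_def)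
    then show ?thesis using cJ by simp
  qed
  \<comment> \<open>Because l < d, at least one index is not exceptional, and at this index \<delta>
    rules out small s.\<close>
  have "{i. i < d \<and> \<not> near_int \<epsilon> (of_int s * \<alpha> i - 1/2)} \<noteq> {..<d}"
    using bad l by (metis card_lessThan not_le)
  then obtain i where i: "i < d" "near_int \<epsilon> (of_int s * \<alpha> i - 1/2)"
    by blast
  then have "\<bar>s\<bar> > R" using \<delta>(2) \<epsilon>(2) near_int_mono by (meson not_le)
  moreover have "card {i. i < d \<and> \<not> near_int \<eta> (of_int s * \<alpha> i - 1/2)} \<le> card {i. i < d \<and> \<not> near_int \<epsilon> (of_int s * \<alpha> i - 1/2)}"
    using \<epsilon>(3) by (intro card_mono) (auto intro: near_int_mono)
  moreover have "near_int (1 / real (Suc l)) (of_int (s - t) * \<beta> i)" if "i < l" for i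
    using n(1) that \<epsilon>(4) near_int_mono by (auto simp: s_def)
  ultimately show ?thesis using bad by (intro exI[of _ s]) auto
qed

lemma open_near_int: "open {\<beta> :: nat \<Rightarrow> real. near_int \<delta> (c * \<beta> i)}"
proof -
  have "{\<beta> :: nat \<Rightarrow> real. near_int \<delta> (c * \<beta> i)} = (\<Union>k::int. {\<beta>. \<bar>c * \<beta> i - of_int k\<bar> < \<delta>})"
    by (auto simp: near_int_def)
  moreover have "open {\<beta> :: nat \<Rightarrow> real. \<bar>c * \<beta> i - of_int k\<bar> < \<delta>}" for k :: int
    by (intro open_Collect_less continuous_intros continuous_on_product_coordinates)
  ultimately show ?thesis by auto
qed

text \<open>Tychonoff's theorem. The cube collects all sequences of frequencies, so that a finite
  subcover serves all of them at once.\<close>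

lemma compact_unit_cube: "compact {\<beta> :: nat \<Rightarrow> real. \<forall>i. \<beta> i \<in> {0..1}}"
proof -
  have "{\<beta> :: nat \<Rightarrow> real. \<forall>i. \<beta> i \<in> {0..1}} = PiE UNIV (\<lambda>_. {0..1})"
    by (auto simp: PiE_def Pi_def extensional_def)
  moreover have "compactin (product_topology (\<lambda>_. euclidean) UNIV) (PiE UNIV (\<lambda>_::nat. {0..1::real}))"
    by (subst compactin_PiE) auto
  ultimately show ?thesis
    by (simp add: euclidean_product_topology)
qed

text \<open>Since s - t is an integer, only the fractional parts of \<beta> matter, and these lie in
  the compact unit cube. For fixed t the conditions for the various s are open and cover the cube by
  \<open>stage_pointwise\<close>; finitely many s suffice, and only finitely many t occur.\<close>

lemma stage_finite:
  assumes \<alpha>: "rat_indep \<alpha> d" and l: "l < d" and \<eta>: "\<eta> > 0"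
  shows "\<exists>S::int set. finite S \<and>
           (\<forall>s\<in>S. card {i. i < d \<and> \<not> near_int \<eta> (of_int s * \<alpha> i - 1/2)} \<le> l \<and> \<bar>s\<bar> > R) \<and>
           (\<forall>t \<beta>. \<bar>t\<bar> \<le> int l \<longrightarrow> (\<exists>s\<in>S. \<forall>i<l. near_int (1 / real (Suc l)) (of_int (s - t) * \<beta> i)))"
proof -
  define G where "G = {s::int. card {i. i < d \<and> \<not> near_int \<eta> (of_int s * \<alpha> i - 1/2)} \<le> l \<and> \<bar>s\<bar> > R}"
  define N where "N t s = {\<beta> :: nat \<Rightarrow> real. \<forall>i\<in>{..<l}. near_int (1 / real (Suc l)) (of_int (s - t) * \<beta> i)}" for t s :: int
  have "\<exists>S\<subseteq>G. finite S \<and> {\<beta>. \<forall>i. \<beta> i \<in> {0..1}} \<subseteq> (\<Union>s\<in>S. N t s)" for t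
  proof (rule compactE_image[OF compact_unit_cube])
    show "open (N t s)" for s
    proof -
      have "N t s = (\<Inter>i\<in>{..<l}. {\<beta>. near_int (1 / real (Suc l)) (of_int (s - t) * \<beta> i)})"
        by (auto simp: N_def)
      then show ?thesis by (simp add: open_INT open_near_int)
    qed
    show "{\<beta>. \<forall>i. \<beta> i \<in> {0..1}} \<subseteq> (\<Union>s\<in>G. N t s)"
      using stage_pointwise[OF \<alpha> l \<eta>, of R t] by (force simp: N_def G_def)
  qed blast
  then obtain F where F: "\<And>t. F t \<subseteq> G" "\<And>t. finite (F t)" "\<And>t. {\<beta>. \<forall>i. \<beta> i \<in> {0..1}} \<subseteq> (\<Union>s\<in>F t. N t s)"
    by metis
  define S where "S = (\<Union>t\<in>{-int l..int l}. F t)"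
  have "\<exists>s\<in>S. \<forall>i<l. near_int (1 / real (Suc l)) (of_int (s - t) * \<beta> i)" if "\<bar>t\<bar> \<le> int l" for t \<beta>
  proof -
    have "(\<lambda>i. frac (\<beta> i)) \<in> {\<beta>. \<forall>i. \<beta> i \<in> {0..1}}"
      by (auto simp: less_imp_le[OF frac_lt_1])
    then have "(\<lambda>i. frac (\<beta> i)) \<in> (\<Union>s\<in>F t. N t s)" by (rule subsetD[OF F(3)])
    then obtain s where s: "s \<in> F t" "(\<lambda>i. frac (\<beta> i)) \<in> N t s" by blast
    have "near_int (1 / real (Suc l)) (of_int (s - t) * \<beta> i)" if "i < l" for i
    proof -
      have "near_int (1 / real (Suc l)) (of_int (s - t) * frac (\<beta> i))"
        using s(2) that unfolding N_def by blast
      moreover have "of_int (s - t) * \<beta> i = of_int (s - t) * frac (\<beta> i) + of_int ((s - t) * \<lfloor>\<beta> i\<rfloor>)"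
        by (simp add: frac_def algebra_simps)
      ultimately show ?thesis by (metis near_int_shift)
    qed
    moreover have "s \<in> S" using s(1) \<open>\<bar>t\<bar> \<le> int l\<close> by (auto simp: S_def abs_le_iff)
    ultimately show ?thesis by blast
  qed
  moreover have "finite S" using F(2) by (auto simp: S_def)
  moreover have "S \<subseteq> G" using F(1) by (auto simp: S_def)
  then have "\<forall>s\<in>S. card {i. i < d \<and> \<not> near_int \<eta> (of_int s * \<alpha> i - 1/2)} \<le> l \<and> \<bar>s\<bar> > R"
    by (auto simp: G_def)
  ultimately show ?thesis by (intro exI[of _ S]) simp
qed

text \<open>A chord of the unit circle is no longer than the arc.\<close>

lemma norm_cis_diff_le: "norm (cis a - cis b) \<le> \<bar>a - b\<bar>"
proof -
  have "cis a - cis b = cis b * (cis (a - b) - 1)"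
    by (simp add: cis_mult right_diff_distrib)
  then have "norm (cis a - cis b) = norm (cis (a - b) - 1)"
    by (simp add: norm_mult)
  also have "\<dots> = 2 * \<bar>sin ((a - b) / 2)\<bar>"
    unfolding cis_conv_exp by (rule dist_exp_i_1)
  also have "\<dots> \<le> 2 * \<bar>(a - b) / 2\<bar>"
    using abs_sin_x_le_abs_x[of "(a - b) / 2"] by linarith
  finally show ?thesis by simp
qed

text \<open>For x near 1/2 modulo 1 the angle is near an odd multiple of pi, where
  \<open>cis\<close> equals -1.\<close>

lemma norm_one_plus_cis_le:
  assumes "near_int \<eta> (x - 1/2)"
  shows "norm (1 + cis (2 * pi * x)) \<le> 2 * pi * \<eta>"
proof -
  obtain k :: int where k: "\<bar>x - 1/2 - of_int k\<bar> < \<eta>" using assms by (auto simp: near_int_def)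
  have "cis (pi + 2 * pi * of_int k) = cis pi * cis (2 * pi * of_int k)" by (rule cis_mult[symmetric])
  then have "cis (pi + 2 * pi * of_int k) = - 1" by simp
  then have "norm (1 + cis (2 * pi * x)) = norm (cis (2 * pi * x) - cis (pi + 2 * pi * of_int k))"
    by (simp add: add.commute)
  also have "\<dots> \<le> \<bar>2 * pi * x - (pi + 2 * pi * of_int k)\<bar>" by (rule norm_cis_diff_le)
  also have "2 * pi * x - (pi + 2 * pi * of_int k) = 2 * pi * (x - 1/2 - of_int k)"
    by (simp add: algebra_simps)
  also have "\<bar>\<dots>\<bar> = 2 * pi * \<bar>x - 1/2 - of_int k\<bar>"
    by (simp add: abs_mult)
  also have "\<dots> \<le> 2 * pi * \<eta>" using k by simp
  finally show ?thesis .
qed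

text \<open>
  The intervals \<open>{c l + 1..c l + l}\<close> will contain the pieces of the set \<open>A\<close>: elements of \<open>S k\<close> are too
  small to join two of them once \<open>l \<ge> k\<close>, and too large to join earlier ones.
\<close>

lemma construction:
  fixes d :: "nat \<Rightarrow> nat"
  assumes d: "\<And>l. d l \<le> d (Suc l)" "\<And>l. l < d l"
  shows "\<exists>(\<alpha> :: nat \<Rightarrow> real) (S :: nat \<Rightarrow> int set) (c :: nat \<Rightarrow> int).
    (\<forall>l. \<forall>s\<in>S l. card {i. i < d l \<and> 1 / real (d l) < norm (1 + cis (2 * pi * (of_int s * \<alpha> i)))} \<le> l) \<and>
    (\<forall>l m i. \<forall>s\<in>S l. l \<le> m \<longrightarrow> d m \<le> i \<longrightarrow> i < d (Suc m) \<longrightarrow>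
       norm (cis (2 * pi * (of_int s * \<alpha> i)) - cis (2 * pi * (of_int s * \<alpha> (i mod d m))))
         \<le> 1 / (2 ^ Suc m * real (d (Suc m)))) \<and>
    (\<forall>l. 0 \<le> c l \<and> c l + int l \<le> c (Suc l)) \<and>
    (\<forall>l. \<forall>s\<in>S (Suc l). c l + int l < \<bar>s\<bar>) \<and>
    (\<forall>k l. k \<le> Suc l \<longrightarrow> (\<forall>s\<in>S k. c l + int l + \<bar>s\<bar> \<le> c (Suc l))) \<and>
    (\<forall>l t \<beta>. 0 < l \<longrightarrow> \<bar>t\<bar> \<le> int l \<longrightarrow> (\<exists>s\<in>S l. \<forall>i<l. near_int (1 / real (Suc l)) (of_int (s - t) * \<beta> i)))"
proof -
  \<comment> \<open>A state consists of the frequencies fixed so far (those below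
    \<open>d n\<close>), the current set S, the union F of all sets up to now, and the offset c of
    the current interval.\<close>
  define P :: "nat \<Rightarrow> (nat \<Rightarrow> real) \<times> int set \<times> int set \<times> int \<Rightarrow> bool" where
    "P n = (\<lambda>(\<alpha>, S, F, c). rat_indep \<alpha> (d n) \<and> finite F \<and> S \<subseteq> F \<and> 0 \<le> c \<and> (n = 0 \<longrightarrow> F = {}))" for n
  define Q :: "nat \<Rightarrow> (nat \<Rightarrow> real) \<times> int set \<times> int set \<times> int \<Rightarrow> (nat \<Rightarrow> real) \<times> int set \<times> int set \<times> int \<Rightarrow> bool" where
    "Q n = (\<lambda>(\<alpha>, S, F, c) (\<alpha>', S', F', c').
      (\<forall>i<d n. \<alpha>' i = \<alpha> i) \<and>
      (\<forall>s\<in>F. \<forall>i. d n \<le> i \<longrightarrow> i < d (Suc n) \<longrightarrow>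
        norm (cis (2 * pi * (of_int s * \<alpha>' i)) - cis (2 * pi * (of_int s * \<alpha> (i mod d n))))
         \<le> 1 / (2 ^ Suc n * real (d (Suc n)))) \<and>
      F' = F \<union> S' \<and>
      (\<forall>s\<in>S'. card {i. i < d (Suc n) \<and> 1 / real (d (Suc n)) < norm (1 + cis (2 * pi * (of_int s * \<alpha>' i)))} \<le> Suc n
         \<and> c + int n < \<bar>s\<bar>) \<and>
      (\<forall>t \<beta>. \<bar>t\<bar> \<le> int (Suc n) \<longrightarrow> (\<exists>s\<in>S'. \<forall>i<Suc n. near_int (1 / real (Suc (Suc n))) (of_int (s - t) * \<beta> i))) \<and>
      (\<forall>s\<in>F'. c + int n + \<bar>s\<bar> \<le> c') \<and> c + int n \<le> c')" for n
  have dpos: "d n > 0" for n using d(2)[of n] by linarith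
  have "\<exists>f. \<forall>n. P n (f n) \<and> Q n (f n) (f (Suc n))"
  proof (rule dependent_nat_choice)
    have "rat_indep (\<lambda>_. 0) 0" by (simp add: rat_indep_def)
    from rat_indep_extend[OF this, of "d 0" 1 "\<lambda>_. 0"]
    obtain \<alpha> where "rat_indep \<alpha> (d 0)" by auto
    then show "\<exists>x. P 0 x" by (intro exI[of _ "(\<alpha>, {}, {}, 0)"]) (simp add: P_def)
  next
    fix x n assume "P n x"
    obtain \<alpha> S F c where x: "x = (\<alpha>, S, F, c)" by (cases x)
    with \<open>P n x\<close> have P: "rat_indep \<alpha> (d n)" "finite F" "S \<subseteq> F" "0 \<le> c"
      by (auto simp: P_def)
    define D where "D = d (Suc n)"
    have D: "D > 0" using dpos by (simp add: D_def)
    \<comment> \<open>M bounds all s found so far; the summand 1 keeps it positive when F is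
      empty.\<close>
    define M where "M = 1 + (\<Sum>s\<in>F. \<bar>s\<bar>)"
    have M: "\<bar>s\<bar> \<le> M" if "s \<in> F" for s
      using member_le_sum[of s F "\<lambda>s. \<bar>s\<bar>"] P(2) that by (simp add: M_def)
    have M0: "M > 0" unfolding M_def by (intro add_pos_nonneg sum_nonneg) auto
    \<comment> \<open>Moving a frequency by \<tau> changes its character value at any s in F by at
      most 2 * pi * M * \<tau>, which is the permitted error.\<close>
    define \<tau> where "\<tau> = 1 / (2 ^ Suc n * real D) / (2 * pi * of_int M)"
    have \<tau>: "\<tau> > 0" using D M0 by (simp add: \<tau>_def)
    obtain \<alpha>' where \<alpha>': "\<forall>i<d n. \<alpha>' i = \<alpha> i" "rat_indep \<alpha>' D"
      "\<forall>i. d n \<le> i \<and> i < D \<longrightarrow> \<bar>\<alpha>' i - \<alpha> (i mod d n)\<bar> < \<tau>"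
      using rat_indep_extend[OF P(1) d(1) \<tau>, of "\<lambda>i. \<alpha> (i mod d n)"] unfolding D_def by (elim exE conjE)
    have near: "norm (cis (2 * pi * (of_int s * \<alpha>' i)) - cis (2 * pi * (of_int s * \<alpha> (i mod d n)))) \<le> 1 / (2 ^ Suc n * real D)"
      if "s \<in> F" "d n \<le> i" "i < D" for s i
    proof -
      have "norm (cis (2 * pi * (of_int s * \<alpha>' i)) - cis (2 * pi * (of_int s * \<alpha> (i mod d n))))
          \<le> \<bar>2 * pi * (of_int s * \<alpha>' i) - 2 * pi * (of_int s * \<alpha> (i mod d n))\<bar>"
        by (rule norm_cis_diff_le)
      also have "\<dots> = 2 * pi * real_of_int \<bar>s\<bar> * \<bar>\<alpha>' i - \<alpha> (i mod d n)\<bar>"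
        by (simp add: abs_mult flip: right_diff_distrib)
      also have "\<dots> \<le> 2 * pi * of_int M * \<tau>"
        using M[OF that(1)] \<alpha>'(3) that(2,3) M0 by (intro mult_mono) (auto intro: less_imp_le)
      also have "\<dots> = 1 / (2 ^ Suc n * real D)" using M0 by (simp add: \<tau>_def)
      finally show ?thesis .
    qed
    \<comment> \<open>With this choice the bound 2 * pi * \<eta> of
      \<open>norm_one_plus_cis_le\<close> is exactly 1 / D.\<close>
    define \<eta> where "\<eta> = 1 / (2 * pi * real D)"
    have \<eta>: "\<eta> > 0" using D by (simp add: \<eta>_def)
    have "Suc n < D" using d(2) by (simp add: D_def)
    from stage_finite[OF \<alpha>'(2) this \<eta>, of "c + int n"]
    obtain S' where S': "finite S'"
      "\<forall>s\<in>S'. card {i. i < D \<and> \<not> near_int \<eta> (of_int s * \<alpha>' i - 1/2)} \<le> Suc n \<and> c + int n < \<bar>s\<bar>"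
      "\<forall>t \<beta>. \<bar>t\<bar> \<le> int (Suc n) \<longrightarrow> (\<exists>s\<in>S'. \<forall>i<Suc n. near_int (1 / real (Suc (Suc n))) (of_int (s - t) * \<beta> i))"
      by (elim exE conjE)
    have card: "card {i. i < D \<and> 1 / real D < norm (1 + cis (2 * pi * (of_int s * \<alpha>' i)))} \<le> Suc n"
      if "s \<in> S'" for s
    proof -
      have "2 * pi * \<eta> = 1 / real D" using D by (simp add: \<eta>_def)
      then have sub: "{i. i < D \<and> 1 / real D < norm (1 + cis (2 * pi * (of_int s * \<alpha>' i)))}
           \<subseteq> {i. i < D \<and> \<not> near_int \<eta> (of_int s * \<alpha>' i - 1/2)}"
        by (auto simp: not_less[symmetric] dest!: norm_one_plus_cis_le)
      have "card {i. i < D \<and> 1 / real D < norm (1 + cis (2 * pi * (of_int s * \<alpha>' i)))}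
          \<le> card {i. i < D \<and> \<not> near_int \<eta> (of_int s * \<alpha>' i - 1/2)}"
        by (rule card_mono[OF _ sub]) simp
      also have "\<dots> \<le> Suc n" using S'(2) that by blast
      finally show ?thesis .
    qed
    \<comment> \<open>The gap between the current interval and the next one is at least the absolute
      value of every s chosen so far.\<close>
    define c' where "c' = c + int n + (\<Sum>s\<in>F \<union> S'. \<bar>s\<bar>)"
    have c': "c + int n + \<bar>s\<bar> \<le> c'" if "s \<in> F \<union> S'" for s
      using member_le_sum[of s "F \<union> S'" "\<lambda>s. \<bar>s\<bar>"] P(2) S'(1) that by (simp add: c'_def)
    have c'2: "c + int n \<le> c'" by (simp add: c'_def sum_nonneg)
    have "P (Suc n) (\<alpha>', S', F \<union> S', c')"
      using \<alpha>'(2) P(2,4) S'(1) c'2 by (simp add: P_def D_def)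
    moreover have "Q n x (\<alpha>', S', F \<union> S', c')"
      unfolding Q_def x prod.case using \<alpha>'(1) near S'(2,3) card c' c'2 unfolding D_def
      by (intro conjI) (simp_all del: of_nat_Suc)
    ultimately show "\<exists>y. P (Suc n) y \<and> Q n x y" by blast
  qed
  then obtain f where f: "\<And>n. P n (f n)" "\<And>n. Q n (f n) (f (Suc n))" by blast
  define A where "A n = fst (f n)" for n
  define S where "S n = fst (snd (f n))" for n
  define F where "F n = fst (snd (snd (f n)))" for n
  define c where "c n = snd (snd (snd (f n)))" for n
  have f_eq: "f n = (A n, S n, F n, c n)" for n by (simp add: A_def S_def F_def c_def)
  have P: "rat_indep (A n) (d n)" "finite (F n)" "S n \<subseteq> F n" "0 \<le> c n" "n = 0 \<longrightarrow> F n = {}" for n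
    using f(1)[of n] unfolding f_eq P_def prod.case by blast+
  have Q: "\<forall>i<d n. A (Suc n) i = A n i"
      "\<forall>s\<in>F n. \<forall>i. d n \<le> i \<longrightarrow> i < d (Suc n) \<longrightarrow>
        norm (cis (2 * pi * (of_int s * A (Suc n) i)) - cis (2 * pi * (of_int s * A n (i mod d n))))
         \<le> 1 / (2 ^ Suc n * real (d (Suc n)))"
      "F (Suc n) = F n \<union> S (Suc n)"
      "\<forall>s\<in>S (Suc n). card {i. i < d (Suc n) \<and> 1 / real (d (Suc n)) < norm (1 + cis (2 * pi * (of_int s * A (Suc n) i)))} \<le> Suc n
         \<and> c n + int n < \<bar>s\<bar>"
      "\<forall>t \<beta>. \<bar>t\<bar> \<le> int (Suc n) \<longrightarrow> (\<exists>s\<in>S (Suc n). \<forall>i<Suc n. near_int (1 / real (Suc (Suc n))) (of_int (s - t) * \<beta> i))"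
      "\<forall>s\<in>F (Suc n). c n + int n + \<bar>s\<bar> \<le> c (Suc n)" "c n + int n \<le> c (Suc n)" for n
    using f(2)[of n] unfolding f_eq Q_def prod.case by blast+
  have SF: "S k \<subseteq> F n" if "k \<le> n" for k n
    using that by (induction n rule: dec_induct) (use P(3) Q(3) in auto)
  have dmono: "d k \<le> d n" if "k \<le> n" for k n
    using that by (rule lift_Suc_mono_le[of d, OF d(1)])
  have A_stable: "A n i = A k i" if "k \<le> n" "i < d k" for k n i
    using that(1)
  proof (induction n rule: dec_induct)
    case (step m)
    have "i < d m" using that(2) dmono[OF step(1)] by linarith
    then show ?case using Q(1)[of m] step(3) by simp
  qed simp
  \<comment> \<open>The limit sequence is diagonal: \<open>A n i\<close> stays constant in n once i
    < \<open>d n\<close>, and i < \<open>d i\<close> holds always.\<close>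
  define \<alpha> where "\<alpha> i = A i i" for i
  have \<alpha>: "\<alpha> i = A n i" if "i < d n" for i n
    using A_stable[of i n i] A_stable[of n i i] that d(2)[of i] unfolding \<alpha>_def
    by (cases "i \<le> n") auto
  \<comment> \<open>Stage 0 only starts the recursion; with an empty set its claim on exceptional
    indices is trivial, and approximation is asserted from stage 1 on.\<close>
  have S0: "S 0 = {}" using P(3)[of 0] P(5)[of 0] by simp
  have "card {i. i < d l \<and> 1 / real (d l) < norm (1 + cis (2 * pi * (of_int s * \<alpha> i)))} \<le> l"
    if "s \<in> S l" for s l
  proof (cases l)
    case 0 then show ?thesis using that S0 by simp
  next
    case (Suc n)
    have "{i. i < d l \<and> 1 / real (d l) < norm (1 + cis (2 * pi * (of_int s * \<alpha> i)))} =
      {i. i < d l \<and> 1 / real (d l) < norm (1 + cis (2 * pi * (of_int s * A l i)))}"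
      using \<alpha> by auto
    then show ?thesis using Q(4)[of n] that Suc by simp
  qed
  moreover have "norm (cis (2 * pi * (of_int s * \<alpha> i)) - cis (2 * pi * (of_int s * \<alpha> (i mod d m))))
         \<le> 1 / (2 ^ Suc m * real (d (Suc m)))"
    if "s \<in> S l" "l \<le> m" "d m \<le> i" "i < d (Suc m)" for s l m i
  proof -
    have "s \<in> F m" using SF that by blast
    then show ?thesis using Q(2)[of m] \<alpha>[OF that(4)] \<alpha>[of "i mod d m" m] dpos[of m] that(3,4) by simp
  qed
  moreover have "c l + int l + \<bar>s\<bar> \<le> c (Suc l)" if "k \<le> Suc l" "s \<in> S k" for k l s
    using Q(6)[of l] SF[OF that(1)] that(2) by blast
  moreover have "\<exists>s\<in>S l. \<forall>i<l. near_int (1 / real (Suc l)) (of_int (s - t) * \<beta> i)"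
    if "0 < l" "\<bar>t\<bar> \<le> int l" for l t \<beta>
    using Q(5)[of "l - 1"] that by simp
  moreover have "0 \<le> c l \<and> c l + int l \<le> c (Suc l)" "\<forall>s\<in>S (Suc l). c l + int l < \<bar>s\<bar>" for l
    using P(4)[of l] Q(7)[of l] Q(4)[of l] by auto
  ultimately show ?thesis
    by (intro exI[of _ \<alpha>] exI[of _ S] exI[of _ c]) simp
qed

section \<open>Gaussian sums\<close>

context prob_space
begin

text \<open>Markov's inequality for the fourth moment, which is 3. The fourth power matters: at
  level m there are \<open>d m\<close> residue classes with K^2 of order \<open>d m\<close> up to a
  factor polynomial in m, so a bound of order 1/K^2 would not survive the union over the
  classes.\<close>

lemma std_normal_tail:
  assumes Y: "distributed M lborel Y std_normal_density" and K: "K > 0"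
  shows "prob {\<omega> \<in> space M. K \<le> \<bar>Y \<omega>\<bar>} \<le> 3 / K ^ 4"
proof -
  have [measurable]: "Y \<in> borel_measurable M"
    using distributed_measurable[OF Y] by simp
  have "integrable lborel (\<lambda>x. std_normal_density x * x ^ 4)"
    by (rule integrable_std_normal_moment)
  then have int: "integrable M (\<lambda>\<omega>. Y \<omega> ^ 4)"
    by (subst (asm) distributed_integrable[OF Y]) auto
  have "expectation (\<lambda>\<omega>. Y \<omega> ^ 4) = (\<integral>x. std_normal_density x * x ^ 4 \<partial>lborel)"
    by (subst distributed_integral[OF Y]) auto
  also have "\<dots> = 3"
    using integral_std_normal_moment_even[of 2] by (simp add: fact_numeral)
  finally have E: "expectation (\<lambda>\<omega>. Y \<omega> ^ 4) = 3" .
  have "{\<omega> \<in> space M. K \<le> \<bar>Y \<omega>\<bar>} \<subseteq> {\<omega> \<in> space M. K ^ 4 \<le> Y \<omega> ^ 4}"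
    using K power_mono[of K "\<bar>Y _\<bar>" 4] by (auto simp: power_even_abs)
  then have "prob {\<omega> \<in> space M. K \<le> \<bar>Y \<omega>\<bar>} \<le> prob {\<omega> \<in> space M. K ^ 4 \<le> Y \<omega> ^ 4}"
    by (intro finite_measure_mono) auto
  also have "\<dots> \<le> expectation (\<lambda>\<omega>. Y \<omega> ^ 4) / K ^ 4"
    using K by (intro integral_Markov_inequality_measure[OF int, of "{}"]) auto
  finally show ?thesis using E by simp
qed

text \<open>The density is at most 1/2, so the interval from -\<delta> to \<delta> has mass at most
  \<delta>; by symmetry the two tails share the remainder equally.\<close>

lemma std_normal_upper:
  assumes Y: "distributed M lborel Y std_normal_density" and "\<delta> > 0"
  shows "(1 - \<delta>) / 2 \<le> prob {\<omega> \<in> space M. \<delta> < Y \<omega>}"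
proof -
  have Y': "distributed M lborel (\<lambda>\<omega>. - Y \<omega>) std_normal_density"
    using normal_density_affine[OF Y, of "-1" 0] by simp
  have [measurable]: "Y \<in> borel_measurable M"
    using distributed_measurable[OF Y] by simp
  have "emeasure M {\<omega> \<in> space M. \<bar>Y \<omega>\<bar> \<le> \<delta>} = emeasure M (Y -` {-\<delta>..\<delta>} \<inter> space M)"
    by (intro arg_cong[where f = "emeasure M"]) (auto simp: abs_le_iff)
  also have "\<dots> = (\<integral>\<^sup>+x. ennreal (std_normal_density x) * indicator {-\<delta>..\<delta>} x \<partial>lborel)"
    by (intro distributed_emeasure[OF Y]) auto
  also have "\<dots> \<le> (\<integral>\<^sup>+x. ennreal (1/2) * indicator {-\<delta>..\<delta>} x \<partial>lborel)"
  proof (intro nn_integral_mono mult_right_mono ennreal_leI)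
    fix x :: real
    have "2 \<le> sqrt (2 * pi)" using pi_ge_two by (intro real_le_rsqrt) auto
    then have "1 / sqrt (2 * pi) \<le> 1 / 2" by (intro divide_left_mono) auto
    moreover have "exp (- x\<^sup>2 / 2) \<le> 1" by simp
    ultimately have "1 / sqrt (2 * pi) * exp (- x\<^sup>2 / 2) \<le> 1 / 2 * 1"
      by (intro mult_mono) auto
    then show "std_normal_density x \<le> 1 / 2"
      by (simp add: std_normal_density_def)
  qed auto
  also have "\<dots> = ennreal (1/2) * ennreal (2 * \<delta>)"
    using \<open>\<delta> > 0\<close> by (subst nn_integral_cmult_indicator) auto
  also have "\<dots> = ennreal \<delta>" using \<open>\<delta> > 0\<close> by (subst ennreal_mult[symmetric]) auto
  finally have mid: "prob {\<omega> \<in> space M. \<bar>Y \<omega>\<bar> \<le> \<delta>} \<le> \<delta>"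
    using \<open>\<delta> > 0\<close> by (simp add: emeasure_eq_measure)
  have "emeasure M (Y -` {\<delta><..} \<inter> space M) = emeasure M ((\<lambda>\<omega>. - Y \<omega>) -` {\<delta><..} \<inter> space M)"
    by (subst distributed_emeasure[OF Y], simp, subst distributed_emeasure[OF Y']) auto
  moreover have "Y -` {\<delta><..} \<inter> space M = {\<omega> \<in> space M. \<delta> < Y \<omega>}"
      "(\<lambda>\<omega>. - Y \<omega>) -` {\<delta><..} \<inter> space M = {\<omega> \<in> space M. Y \<omega> < - \<delta>}" by auto
  ultimately have sym: "prob {\<omega> \<in> space M. \<delta> < Y \<omega>} = prob {\<omega> \<in> space M. Y \<omega> < - \<delta>}"
    by (simp add: emeasure_eq_measure)
  have "1 = prob (space M)" by (simp add: prob_space)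
  also have "space M = {\<omega> \<in> space M. \<delta> < Y \<omega>} \<union> {\<omega> \<in> space M. Y \<omega> < - \<delta>} \<union> {\<omega> \<in> space M. \<bar>Y \<omega>\<bar> \<le> \<delta>}"
    by auto
  also have "prob \<dots> \<le> prob {\<omega> \<in> space M. \<delta> < Y \<omega>} + prob {\<omega> \<in> space M. Y \<omega> < - \<delta>} + prob {\<omega> \<in> space M. \<bar>Y \<omega>\<bar> \<le> \<delta>}"
    by (intro order_trans[OF measure_Un_le] add_mono) auto
  finally show ?thesis using sym mid by simp
qed

lemma std_normal_linear_form:
  fixes a :: "'i \<Rightarrow> real" and g :: "'i \<Rightarrow> 'a \<Rightarrow> real"
  assumes I: "finite I" and indep: "indep_vars (\<lambda>_. borel) g I"
    and g: "\<And>i. i \<in> I \<Longrightarrow> distributed M lborel (g i) std_normal_density"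
    and a: "(\<Sum>i\<in>I. (a i)\<^sup>2) = 1"
  shows "distributed M lborel (\<lambda>\<omega>. \<Sum>i\<in>I. a i * g i \<omega>) std_normal_density"
proof -
  \<comment> \<open>Terms with coefficient 0 are dropped, because a normal density needs a positive
    deviation.\<close>
  define J where "J = {i \<in> I. a i \<noteq> 0}"
  have J: "finite J" "J \<subseteq> I" using I by (auto simp: J_def)
  have aJ: "(\<Sum>i\<in>J. (a i)\<^sup>2) = 1"
    unfolding a[symmetric] using I by (intro sum.mono_neutral_left) (auto simp: J_def)
  then have "J \<noteq> {}" by auto
  have "indep_vars (\<lambda>_. borel) g J"
    by (rule indep_vars_subset[OF indep J(2)])
  then have "indep_vars (\<lambda>_. borel) (\<lambda>i \<omega>. a i * g i \<omega>) J"
    by (rule indep_vars_compose2[where Y = "\<lambda>i x. a i * x"]) auto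
  moreover have "distributed M lborel (\<lambda>\<omega>. a i * g i \<omega>) (normal_density 0 \<bar>a i\<bar>)" if "i \<in> J" for i
    using normal_density_affine[OF g[of i], of "a i" 0] that by (simp add: J_def)
  ultimately have "distributed M lborel (\<lambda>\<omega>. \<Sum>i\<in>J. a i * g i \<omega>)
      (normal_density (\<Sum>i\<in>J. 0) (sqrt (\<Sum>i\<in>J. \<bar>a i\<bar>\<^sup>2)))"
    by (intro sum_indep_normal[OF J(1) \<open>J \<noteq> {}\<close>]) (auto simp: J_def)
  moreover have "(\<lambda>\<omega>. \<Sum>i\<in>J. a i * g i \<omega>) = (\<lambda>\<omega>. \<Sum>i\<in>I. a i * g i \<omega>)"
    using I by (intro ext sum.mono_neutral_left) (auto simp: J_def)
  ultimately show ?thesis using aJ by simp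
qed

text \<open>First moment method: the expected number of events that occur is the sum of the
  probabilities, so some outcome reaches it.\<close>

lemma exists_card_ge:
  assumes X: "finite X" and E: "\<And>x. x \<in> X \<Longrightarrow> E x \<in> events" and q: "q \<le> (\<Sum>x\<in>X. prob (E x))"
  shows "\<exists>\<omega>\<in>space M. q \<le> real (card {x \<in> X. \<omega> \<in> E x})"
proof (rule ccontr)
  assume "\<not> ?thesis"
  then have less: "real (card {x \<in> X. \<omega> \<in> E x}) < q" if "\<omega> \<in> space M" for \<omega>
    using that by (meson not_le)
  have eq: "real (card {x \<in> X. \<omega> \<in> E x}) = (\<Sum>x\<in>X. indicator (E x) \<omega>)" for \<omega>
    using X by (simp add: indicator_def sum.If_cases Int_def)
  have int: "integrable M (\<lambda>\<omega>. indicator (E x) \<omega> :: real)" if "x \<in> X" for x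
    using E[OF that] by (simp add: less_top[symmetric])
  have "expectation (\<lambda>\<omega>. \<Sum>x\<in>X. indicator (E x) \<omega>) < q"
  proof (rule expectation_less)
    show "integrable M (\<lambda>\<omega>. \<Sum>x\<in>X. indicator (E x) \<omega> :: real)"
      by (rule Bochner_Integration.integrable_sum[OF int])
    show "AE \<omega> in M. (\<Sum>x\<in>X. indicator (E x) \<omega>) < q"
      using less by (intro AE_I2) (simp add: eq[symmetric])
  qed
  also have "expectation (\<lambda>\<omega>. \<Sum>x\<in>X. indicator (E x) \<omega>) = (\<Sum>x\<in>X. prob (E x))"
    using int E by (subst Bochner_Integration.integral_sum) auto
  finally show False using q by simp
qed

text \<open>The family is encoded as 2 n independent real standard normal variables; the flag is
  true for real parts. Thus the mean of |\<xi> j|^2 is 2 and every real projection has variance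
  1.\<close>

definition complex_gaussian_family :: "nat \<Rightarrow> (nat \<Rightarrow> 'a \<Rightarrow> complex) \<Rightarrow> bool" where
  "complex_gaussian_family n \<xi> \<longleftrightarrow>
     indep_vars (\<lambda>_. borel) (\<lambda>(j, b). if b then (\<lambda>\<omega>. Re (\<xi> j \<omega>)) else (\<lambda>\<omega>. Im (\<xi> j \<omega>))) ({..<n} \<times> UNIV) \<and>
     (\<forall>j<n. distributed M lborel (\<lambda>\<omega>. Re (\<xi> j \<omega>)) std_normal_density \<and>
            distributed M lborel (\<lambda>\<omega>. Im (\<xi> j \<omega>)) std_normal_density)"

text \<open>Rotation invariance: Re (z \<xi>) is a linear form in Re \<xi> and Im \<xi> whose
  squared coefficients add up to |z|^2 = 1, so each j contributes variance 1.\<close>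

lemma complex_gaussian_sum_Re:
  assumes \<xi>: "complex_gaussian_family n \<xi>" and J: "J \<subseteq> {..<n}" "J \<noteq> {}"
    and z: "\<And>j. j \<in> J \<Longrightarrow> norm (z j) = 1"
  shows "distributed M lborel (\<lambda>\<omega>. Re (\<Sum>j\<in>J. z j * \<xi> j \<omega>) / sqrt (card J)) std_normal_density"
proof -
  define g where "g = (\<lambda>(j, b). if b then (\<lambda>\<omega>. Re (\<xi> j \<omega>)) else (\<lambda>\<omega>. Im (\<xi> j \<omega>)))"
  define a where "a = (\<lambda>(j, b). (if b then Re (z j) else - Im (z j)) / sqrt (card J))"
  have fin: "finite J" using J(1) finite_subset by blast
  have c: "card J > 0" using fin J(2) by (simp add: card_gt_0_iff)
  have "distributed M lborel (\<lambda>\<omega>. \<Sum>i\<in>J \<times> UNIV. a i * g i \<omega>) std_normal_density"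
  proof (rule std_normal_linear_form)
    show "finite (J \<times> (UNIV :: bool set))" using fin by simp
    show "indep_vars (\<lambda>_. borel) g (J \<times> UNIV)"
      using \<xi> J(1) unfolding complex_gaussian_family_def g_def by (elim conjE indep_vars_subset) auto
    show "distributed M lborel (g i) std_normal_density" if "i \<in> J \<times> UNIV" for i
      using \<xi> J(1) that unfolding complex_gaussian_family_def g_def by (auto split: prod.splits)
    have "(\<Sum>i\<in>J \<times> UNIV. (a i)\<^sup>2) = (\<Sum>j\<in>J. ((Re (z j))\<^sup>2 + (Im (z j))\<^sup>2) / card J)"
      unfolding sum.cartesian_product' by (intro sum.cong) (auto simp: a_def UNIV_bool power_divide add_divide_distrib)
    also have "\<dots> = (\<Sum>j\<in>J. 1 / card J)"
      using z by (intro sum.cong) (auto simp flip: cmod_power2)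
    also have "\<dots> = 1" using c by simp
    finally show "(\<Sum>i\<in>J \<times> UNIV. (a i)\<^sup>2) = 1" .
  qed
  moreover have "(\<Sum>i\<in>J \<times> UNIV. a i * g i \<omega>) = Re (\<Sum>j\<in>J. z j * \<xi> j \<omega>) / sqrt (card J)" for \<omega>
    unfolding sum.cartesian_product' Re_sum sum_divide_distrib
    by (intro sum.cong) (auto simp: a_def g_def UNIV_bool diff_divide_distrib)
  ultimately show ?thesis by simp
qed

text \<open>A large norm forces a large real or imaginary part, and both are normal after scaling.
  The constant is 24 = 2 * 3 * 4: two parts, fourth moment 3, and a factor 4 from the threshold K /
  sqrt 2.\<close>

lemma complex_gaussian_sum_tail:
  assumes \<xi>: "complex_gaussian_family n \<xi>" and J: "J \<subseteq> {..<n}" "J \<noteq> {}"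
    and z: "\<And>j. j \<in> J \<Longrightarrow> norm (z j) = 1" and K: "K > 0"
  shows "prob {\<omega> \<in> space M. K * sqrt (card J) \<le> norm (\<Sum>j\<in>J. z j * \<xi> j \<omega>)} \<le> 24 / K ^ 4"
proof -
  have c: "card J > 0" using J finite_subset by (auto simp: card_gt_0_iff)
  define R where "R \<omega> = Re (\<Sum>j\<in>J. z j * \<xi> j \<omega>) / sqrt (card J)" for \<omega>
  define T where "T \<omega> = Im (\<Sum>j\<in>J. z j * \<xi> j \<omega>) / sqrt (card J)" for \<omega>
  have R: "distributed M lborel R std_normal_density"
    unfolding R_def by (rule complex_gaussian_sum_Re[OF \<xi> J z])
  \<comment> \<open>The imaginary part is the real part after the coefficients are rotated by -\<i>,
    which keeps their modulus.\<close>
  have "Re (\<Sum>j\<in>J. (- \<i> * z j) * \<xi> j \<omega>) = Im (\<Sum>j\<in>J. z j * \<xi> j \<omega>)" for \<omega>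
    unfolding Re_sum Im_sum by (intro sum.cong) auto
  then have T: "distributed M lborel T std_normal_density"
    using complex_gaussian_sum_Re[OF \<xi> J, of "\<lambda>j. - \<i> * z j"] z unfolding T_def by (simp add: norm_mult)
  have [measurable]: "R \<in> borel_measurable M" "T \<in> borel_measurable M"
    using distributed_measurable[OF R] distributed_measurable[OF T] by simp_all
  define K' where "K' = K / sqrt 2"
  have K': "K' > 0" "K' ^ 4 = K ^ 4 / 4" using K by (simp_all add: K'_def power_divide power4_eq_xxxx)
  have "\<omega> \<in> {\<omega> \<in> space M. K' \<le> \<bar>R \<omega>\<bar>} \<union> {\<omega> \<in> space M. K' \<le> \<bar>T \<omega>\<bar>}"
    if \<omega>: "\<omega> \<in> space M" "K * sqrt (card J) \<le> norm (\<Sum>j\<in>J. z j * \<xi> j \<omega>)" for \<omega>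
  proof (rule ccontr)
    assume "\<not> ?thesis"
    then have "\<bar>R \<omega>\<bar> < K'" "\<bar>T \<omega>\<bar> < K'" using \<omega>(1) by auto
    then have "(R \<omega>)\<^sup>2 < K'\<^sup>2" "(T \<omega>)\<^sup>2 < K'\<^sup>2"
      by (simp_all add: abs_less_iff power2_strict_mono)
    moreover have "K'\<^sup>2 + K'\<^sup>2 = K\<^sup>2" by (simp add: K'_def power_divide)
    moreover have "(norm (\<Sum>j\<in>J. z j * \<xi> j \<omega>))\<^sup>2 = card J * ((R \<omega>)\<^sup>2 + (T \<omega>)\<^sup>2)"
      using c by (simp add: cmod_power2 R_def T_def power_divide distrib_left)
    ultimately have "(norm (\<Sum>j\<in>J. z j * \<xi> j \<omega>))\<^sup>2 < card J * K\<^sup>2"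
      using c by simp
    moreover have "(K * sqrt (card J))\<^sup>2 \<le> (norm (\<Sum>j\<in>J. z j * \<xi> j \<omega>))\<^sup>2"
      using \<omega>(2) K by (intro power_mono) auto
    ultimately show False by (simp add: power_mult_distrib mult.commute)
  qed
  then have "prob {\<omega> \<in> space M. K * sqrt (card J) \<le> norm (\<Sum>j\<in>J. z j * \<xi> j \<omega>)}
      \<le> prob ({\<omega> \<in> space M. K' \<le> \<bar>R \<omega>\<bar>} \<union> {\<omega> \<in> space M. K' \<le> \<bar>T \<omega>\<bar>})"
    by (intro finite_measure_mono) auto
  also have "\<dots> \<le> prob {\<omega> \<in> space M. K' \<le> \<bar>R \<omega>\<bar>} + prob {\<omega> \<in> space M. K' \<le> \<bar>T \<omega>\<bar>}"
    by (intro measure_Un_le) auto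
  also have "\<dots> \<le> 3 / K' ^ 4 + 3 / K' ^ 4"
    by (intro add_mono std_normal_tail R T K')
  also have "\<dots> = 24 / K ^ 4" using K by (simp add: K'(2))
  finally show ?thesis .
qed

end

text \<open>The coordinates of a product of 2 n standard normal measures serve as the real and
  imaginary parts.\<close>

lemma exists_complex_gaussian_family:
  "\<exists>(M :: (nat \<times> bool \<Rightarrow> real) measure) \<xi>. prob_space M \<and> prob_space.complex_gaussian_family M n \<xi>"
proof -
  define N where "N = density lborel (\<lambda>x. ennreal (std_normal_density x))"
  define I where "I = {..<n} \<times> (UNIV :: bool set)"
  define M where "M = PiM I (\<lambda>_. N)"
  have N: "prob_space N" unfolding N_def by (rule prob_space_normal_density) simp
  have setsN: "sets N = sets borel" by (simp add: N_def)
  interpret M: prob_space M unfolding M_def by (intro prob_space_PiM N)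
  define \<xi> where "\<xi> j \<omega> = Complex (\<omega> (j, True)) (\<omega> (j, False))" for j :: nat and \<omega> :: "nat \<times> bool \<Rightarrow> real"
  have dist: "distr M borel (\<lambda>\<omega>. \<omega> i) = N" if "i \<in> I" for i
  proof -
    have "distr M borel (\<lambda>\<omega>. \<omega> i) = distr M N (\<lambda>\<omega>. \<omega> i)"
      by (intro distr_cong setsN[symmetric]) auto
    also have "\<dots> = N" unfolding M_def by (rule distr_PiM_component[OF N that])
    finally show ?thesis .
  qed
  have meas: "(\<lambda>\<omega>. \<omega> i) \<in> borel_measurable M" if "i \<in> I" for i
  proof -
    have "(\<lambda>\<omega>. \<omega> i) \<in> measurable M N" unfolding M_def using that by (rule measurable_component_singleton)
    then show ?thesis using measurable_cong_sets[OF refl setsN] by blast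
  qed
  have normal: "distributed M lborel (\<lambda>\<omega>. \<omega> i) std_normal_density" if "i \<in> I" for i
  proof -
    have "distr M lborel (\<lambda>\<omega>. \<omega> i) = distr M borel (\<lambda>\<omega>. \<omega> i)"
      by (intro distr_cong) auto
    then show ?thesis using dist[OF that] meas[OF that] by (simp add: distributed_def N_def)
  qed
  have indep: "M.indep_vars (\<lambda>_. borel) (\<lambda>i \<omega>. \<omega> i) I"
  proof (cases "I = {}")
    case True
    then show ?thesis by (auto simp: M.indep_vars_def M.indep_sets_def)
  next
    case False
    have "distr M (PiM I (\<lambda>_. borel)) (\<lambda>\<omega>. \<lambda>i\<in>I. \<omega> i) = distr M M (\<lambda>\<omega>. \<omega>)"
    proof (rule distr_cong)
      show "sets (PiM I (\<lambda>_. borel)) = sets M"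
        unfolding M_def by (intro sets_PiM_cong) (auto simp: setsN)
    qed (auto simp: M_def space_PiM)
    also have "\<dots> = PiM I (\<lambda>i. distr M borel (\<lambda>\<omega>. \<omega> i))"
      using dist by (simp add: M_def cong: PiM_cong)
    finally show ?thesis
      using meas False by (subst M.indep_vars_iff_distr_eq_PiM') auto
  qed
  have "M.complex_gaussian_family n \<xi>"
    unfolding M.complex_gaussian_family_def
  proof (intro conjI allI impI)
    have "M.indep_vars (\<lambda>_. borel) (\<lambda>(j, b). if b then (\<lambda>\<omega>. Re (\<xi> j \<omega>)) else (\<lambda>\<omega>. Im (\<xi> j \<omega>))) I
      \<longleftrightarrow> M.indep_vars (\<lambda>_. borel) (\<lambda>i \<omega>. \<omega> i) I"
      by (intro M.indep_vars_cong) (auto simp: \<xi>_def)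
    then show "M.indep_vars (\<lambda>_. borel) (\<lambda>(j, b). if b then (\<lambda>\<omega>. Re (\<xi> j \<omega>)) else (\<lambda>\<omega>. Im (\<xi> j \<omega>))) ({..<n} \<times> UNIV)"
      using indep by (simp add: I_def)
  qed (use normal in \<open>auto simp: \<xi>_def I_def\<close>)
  then show ?thesis using M.prob_space_axioms by blast
qed

section \<open>The set \<open>A\<close>\<close>

lemma sum_group_mod:
  fixes w h :: "nat \<Rightarrow> complex"
  assumes "q > 0"
  shows "(\<Sum>j<n. h (j mod q) * w j) = (\<Sum>i<q. h i * (\<Sum>j | j < n \<and> j mod q = i. w j))"
proof -
  have "(\<Sum>j<n. h (j mod q) * w j) = (\<Sum>i<q. \<Sum>j | j \<in> {..<n} \<and> j mod q = i. h (j mod q) * w j)"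
    using assms by (intro sum.group[symmetric]) auto
  also have "\<dots> = (\<Sum>i<q. h i * (\<Sum>j | j < n \<and> j mod q = i. w j))"
    by (intro sum.cong) (auto simp: sum_distrib_left)
  finally show ?thesis .
qed

lemma card_residue_class:
  assumes "q > 0" "i < q"
  shows "card {j. j < q * k \<and> j mod q = i} = k"
proof -
  have "bij_betw (\<lambda>t. i + q * t) {..<k} {j. j < q * k \<and> j mod q = i}"
  proof (rule bij_betwI[where g = "\<lambda>j. j div q"])
    show "(\<lambda>t. i + q * t) \<in> {..<k} \<rightarrow> {j. j < q * k \<and> j mod q = i}"
    proof (intro Pi_I CollectI conjI)
      fix t assume "t \<in> {..<k}"
      then have "q * Suc t \<le> q * k" by (intro mult_le_mono2) auto
      then show "i + q * t < q * k" using assms by simp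
    qed (use assms in auto)
    show "(\<lambda>j. j div q) \<in> {j. j < q * k \<and> j mod q = i} \<rightarrow> {..<k}"
      by (auto simp: less_mult_imp_div_less mult.commute)
  qed (use assms in auto)
  then show ?thesis using bij_betw_same_card by fastforce
qed

text \<open>
  With \<open>W m\<close> the sum in which \<open>v j\<close> is replaced by \<open>v (j mod d m)\<close>, both \<open>W l\<close> and the increments
  \<open>W (m + 1) - W m\<close> are controlled by sums of \<open>w\<close> over residue classes.
\<close>

lemma twisted_sum_bound:
  fixes d :: "nat \<Rightarrow> nat" and v w :: "nat \<Rightarrow> complex"
  assumes d: "\<And>m. d m dvd d (Suc m)" "\<And>m. d m > 0" and B: "B > 0"
    and Z: "\<And>m i. m \<le> L \<Longrightarrow> i < d m \<Longrightarrow> norm (\<Sum>j | j < d L \<and> j mod d m = i. w j) \<le> B / real (2 * m + 1)"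
    and v: "\<And>i. norm (v i) = 1" and l: "l \<le> L"
    and flip: "card {i. i < d l \<and> 1 / real (d l) < norm (1 + v i)} \<le> l"
    and close: "\<And>m i. l \<le> m \<Longrightarrow> d m \<le> i \<Longrightarrow> i < d (Suc m) \<Longrightarrow> norm (v i - v (i mod d m)) \<le> 1 / (2 ^ Suc m * real (d (Suc m)))"
  shows "norm (\<Sum>j<d L. (1 + v j) * w j) < 2 * B"
proof -
  define Z' where "Z' m i = (\<Sum>j | j < d L \<and> j mod d m = i. w j)" for m i
  define W where "W m = (\<Sum>j<d L. (1 + v (j mod d m)) * w j)" for m
  \<comment> \<open>Induction from l: \<open>W l\<close> is at most B, and each passage from m to m
    + 1 costs at most B / 2^(m+1), so that the total stays below 2 * B.\<close>
  have "norm (W m) \<le> B * (2 - 1 / 2 ^ m)" if "l \<le> m" "m \<le> L" for m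
    using that
  proof (induction m rule: dec_induct)
    case base
    define bad where "bad = {i. i < d l \<and> 1 / real (d l) < norm (1 + v i)}"
    have bad: "bad \<subseteq> {..<d l}" by (auto simp: bad_def)
    have two: "norm (1 + v i) \<le> 2" for i using norm_triangle_ineq[of 1 "v i"] v by simp
    have "(\<Sum>i<d l. norm (1 + v i)) = (\<Sum>i\<in>bad. norm (1 + v i)) + (\<Sum>i\<in>{..<d l} - bad. norm (1 + v i))"
      by (subst sum.subset_diff[OF bad]) (simp_all add: add.commute)
    also have "\<dots> \<le> (\<Sum>i\<in>bad. 2) + (\<Sum>i\<in>{..<d l} - bad. 1 / real (d l))"
      using two by (intro add_mono sum_mono) (auto simp: bad_def not_less)
    \<comment> \<open>At most l bad indices contribute 2 each and the others at most 1 together. The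
      result 2 * l + 1 cancels the denominator in \<open>Z\<close>.\<close>
    also have "\<dots> \<le> real (2 * l) + 1"
    proof (rule add_mono)
      show "(\<Sum>i\<in>bad. 2) \<le> real (2 * l)" using flip by (simp add: bad_def)
      have "(\<Sum>i\<in>{..<d l} - bad. 1 / real (d l)) \<le> (\<Sum>i\<in>{..<d l}. 1 / real (d l))"
        by (intro sum_mono2) auto
      then show "(\<Sum>i\<in>{..<d l} - bad. 1 / real (d l)) \<le> 1" using d(2)[of l] by simp
    qed
    finally have total: "(\<Sum>i<d l. norm (1 + v i)) \<le> real (2 * l + 1)" by simp
    have "norm (W l) \<le> (\<Sum>i<d l. norm (1 + v i) * norm (Z' l i))"
      unfolding W_def Z'_def sum_group_mod[OF d(2), of "\<lambda>i. 1 + v i"]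
      by (rule order_trans[OF norm_sum]) (simp add: norm_mult)
    also have "\<dots> \<le> (\<Sum>i<d l. norm (1 + v i) * (B / real (2 * l + 1)))"
      using Z[OF l] by (intro sum_mono mult_left_mono) (auto simp: Z'_def)
    also have "\<dots> = (\<Sum>i<d l. norm (1 + v i)) * (B / real (2 * l + 1))"
      by (rule sum_distrib_right[symmetric])
    also have "\<dots> \<le> real (2 * l + 1) * (B / real (2 * l + 1))"
      using B by (intro mult_right_mono[OF total]) simp
    also have "\<dots> = B" by simp
    also have "B \<le> B * (2 - 1 / 2 ^ l)" using B by simp
    finally show ?case .
  next
    case (step m)
    have dm: "j mod d (Suc m) mod d m = j mod d m" for j
      using d(1) by (simp add: mod_mod_cancel)
    \<comment> \<open>Since \<open>d m\<close> divides \<open>d (Suc m)\<close>, the coefficient of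
      \<open>w j\<close> depends only on j modulo \<open>d (Suc m)\<close>, and the sum can be
      grouped by residues.\<close>
    have "W (Suc m) - W m = (\<Sum>j<d L. (v (j mod d (Suc m)) - v (j mod d (Suc m) mod d m)) * w j)"
      unfolding W_def dm by (simp add: sum_subtractf[symmetric] algebra_simps)
    also have "\<dots> = (\<Sum>i<d (Suc m). (v i - v (i mod d m)) * Z' (Suc m) i)"
      unfolding Z'_def by (rule sum_group_mod[OF d(2), of "\<lambda>i. v i - v (i mod d m)"])
    also have "norm \<dots> \<le> (\<Sum>i<d (Suc m). norm (v i - v (i mod d m)) * norm (Z' (Suc m) i))"
      by (rule order_trans[OF norm_sum]) (simp add: norm_mult)
    also have "\<dots> \<le> (\<Sum>i<d (Suc m). 1 / (2 ^ Suc m * real (d (Suc m))) * B)"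
    proof (intro sum_mono mult_mono)
      fix i assume i: "i \<in> {..<d (Suc m)}"
      \<comment> \<open>For i < \<open>d m\<close> the difference is 0; \<open>close\<close> covers
        the other indices.\<close>
      show "norm (v i - v (i mod d m)) \<le> 1 / (2 ^ Suc m * real (d (Suc m)))"
        using close[of m i] i step(1) by (cases "i < d m") auto
      have "norm (Z' (Suc m) i) \<le> B / real (2 * Suc m + 1)"
        using Z[of "Suc m" i] i step by (simp add: Z'_def)
      also have "\<dots> \<le> B" using B by (simp add: divide_le_eq)
      finally show "norm (Z' (Suc m) i) \<le> B" .
    qed auto
    also have "\<dots> = B / 2 ^ Suc m" using d(2)[of "Suc m"] by simp
    finally have "norm (W (Suc m) - W m) \<le> B / 2 ^ Suc m" .
    moreover have "norm (W m) \<le> B * (2 - 1 / 2 ^ m)" using step by simp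
    ultimately have "norm (W (Suc m)) \<le> B * (2 - 1 / 2 ^ m) + B / 2 ^ Suc m"
      using norm_triangle_sub[of "W (Suc m)" "W m"] by linarith
    also have "\<dots> = B * (2 - 1 / 2 ^ Suc m)" by (simp add: field_simps)
    finally show ?case .
  qed
  from this[OF l order_refl] have "norm (W L) \<le> B * (2 - 1 / 2 ^ L)" .
  also have "\<dots> < B * 2" using B by (intro mult_strict_left_mono) auto
  finally have "norm (W L) < 2 * B" by simp
  moreover have "W L = (\<Sum>j<d L. (1 + v j) * w j)"
    unfolding W_def by (intro sum.cong) auto
  ultimately show ?thesis by simp
qed

text \<open>From the event U that the full sum is large, of probability at least (1 - \<delta>) / 2,
  remove the events V that some residue class contributes too much. A class modulo
  \<open>d m\<close> has \<open>d L / d m\<close> terms, and the tail bound stays summable over all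
  classes and all m; the total loss is 48 / (\<delta>^4 D).\<close>

lemma (in prob_space) gaussian_event:
  fixes d :: "nat \<Rightarrow> nat" and z :: "nat \<Rightarrow> complex"
  assumes D: "D > 0" and d: "\<And>m. d m = D * 162 ^ m" and \<delta>: "\<delta> > 0"
    and \<xi>: "complex_gaussian_family (d L) \<xi>" and z: "\<And>j. norm (z j) = 1"
  shows "\<exists>E\<in>events. (1 - \<delta>) / 2 - 48 / (\<delta> ^ 4 * real D) \<le> prob E \<and>
    (\<forall>\<omega>\<in>E. \<delta> * sqrt (d L) < Re (\<Sum>j<d L. z j * \<xi> j \<omega>) \<and>
      (\<forall>m\<le>L. \<forall>i<d m. norm (\<Sum>j | j < d L \<and> j mod d m = i. z j * \<xi> j \<omega>) \<le> \<delta> * sqrt (d L) / real (2 * m + 1)))"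
proof -
  have dpos: "d m > 0" for m using D by (simp add: d)
  have [measurable]: "\<xi> j \<in> borel_measurable M" if "j < d L" for j
  proof -
    have "distributed M lborel (\<lambda>\<omega>. Re (\<xi> j \<omega>)) std_normal_density" "distributed M lborel (\<lambda>\<omega>. Im (\<xi> j \<omega>)) std_normal_density"
      using \<xi> that by (auto simp: complex_gaussian_family_def)
    then show ?thesis
      using distributed_measurable by (subst borel_measurable_complex_iff) fastforce
  qed
  define U where "U = {\<omega> \<in> space M. \<delta> * sqrt (d L) < Re (\<Sum>j<d L. z j * \<xi> j \<omega>)}"
  define V where "V = (\<lambda>(m, i). {\<omega> \<in> space M. \<delta> * sqrt (d L) / real (2 * m + 1) \<le> norm (\<Sum>j | j < d L \<and> j mod d m = i. z j * \<xi> j \<omega>)})"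
  define I where "I = Sigma {..L} (\<lambda>m. {..<d m})"
  have U: "U \<in> events" unfolding U_def by measurable
  have V: "V p \<in> events" for p
  proof (cases p)
    case (Pair m i)
    have "(\<lambda>\<omega>. \<Sum>j | j < d L \<and> j mod d m = i. z j * \<xi> j \<omega>) \<in> borel_measurable M"
      by (intro borel_measurable_sum borel_measurable_times) auto
    then show ?thesis unfolding V_def Pair prod.case by measurable
  qed
  have "(1 - \<delta>) / 2 \<le> prob {\<omega> \<in> space M. \<delta> < Re (\<Sum>j\<in>{..<d L}. z j * \<xi> j \<omega>) / sqrt (card {..<d L})}"
    using dpos[of L] z \<delta> by (intro std_normal_upper complex_gaussian_sum_Re[OF \<xi>]) auto
  also have "{\<omega> \<in> space M. \<delta> < Re (\<Sum>j\<in>{..<d L}. z j * \<xi> j \<omega>) / sqrt (card {..<d L})} = U"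
    using dpos[of L] by (simp add: U_def pos_less_divide_eq)
  finally have pU: "(1 - \<delta>) / 2 \<le> prob U" .
  have pV: "prob (V (m, i)) \<le> 24 / (\<delta> ^ 4 * real D * 2 ^ m) / real (d m)" if mi: "m \<le> L" "i < d m" for m i
  proof -
    define J where "J = {j. j < d L \<and> j mod d m = i}"
    have "d L = d m * 162 ^ (L - m)"
      using mi(1) by (simp add: d flip: power_add)
    then have cJ: "card J = 162 ^ (L - m)" and dL: "real (d L) = real (d m) * real (card J)"
      unfolding J_def using card_residue_class[OF dpos mi(2)] by simp_all
    \<comment> \<open>K is the threshold measured in units of sqrt (card J), the natural size of the
      sum over one class.\<close>
    define K where "K = \<delta> * sqrt (d m) / real (2 * m + 1)"
    have K: "K > 0" using \<delta> dpos by (simp add: K_def)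
    have "J \<noteq> {}" using cJ by auto
    have KJ: "K * sqrt (card J) = \<delta> * sqrt (d L) / real (2 * m + 1)"
      unfolding dL K_def by (simp add: real_sqrt_mult)
    have "V (m, i) = {\<omega> \<in> space M. K * sqrt (card J) \<le> norm (\<Sum>j\<in>J. z j * \<xi> j \<omega>)}"
      unfolding V_def KJ by (simp add: J_def)
    also have "prob \<dots> \<le> 24 / K ^ 4"
      by (rule complex_gaussian_sum_tail[OF \<xi> _ \<open>J \<noteq> {}\<close> _ K]) (auto simp: J_def z)
    also have "K ^ 4 = \<delta> ^ 4 * real (d m) * real (d m) / real (2 * m + 1) ^ 4"
    proof -
      have "sqrt (d m) ^ 4 = (sqrt (d m))\<^sup>2 * (sqrt (d m))\<^sup>2"
        by (simp only: power4_eq_xxxx power2_eq_square mult.assoc)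
      also have "\<dots> = real (d m) * real (d m)" by simp
      finally have "sqrt (d m) ^ 4 = real (d m) * real (d m)" .
      then show ?thesis by (simp add: K_def power_divide power_mult_distrib)
    qed
    also have "24 / (\<delta> ^ 4 * real (d m) * real (d m) / real (2 * m + 1) ^ 4)
       = 24 * (real (2 * m + 1) ^ 4 / real (d m)) / \<delta> ^ 4 / real (d m)"
      by (simp add: field_simps)
    also have "\<dots> \<le> 24 * (1 / (real D * 2 ^ m)) / \<delta> ^ 4 / real (d m)"
    proof (intro divide_right_mono mult_left_mono)
      \<comment> \<open>The ratio 162 = 2 * 81 is chosen here: 81^m absorbs (2 * m + 1)^4, which is
        at most (3^m)^4, and 2^m makes the sum over m converge.\<close>
      have dm: "real (d m) = real D * 2 ^ m * 81 ^ m"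
        by (simp add: d flip: power_mult_distrib)
      have "real (2 * m + 1) \<le> 3 ^ m"
        by (induction m) auto
      then have "real (2 * m + 1) ^ 4 \<le> (3 ^ m) ^ 4" by (intro power_mono) auto
      also have "(3 ^ m) ^ 4 = ((3::real) ^ 4) ^ m" by (metis power_mult mult.commute)
      also have "\<dots> = 81 ^ m" by simp
      finally have "real (2 * m + 1) ^ 4 \<le> 81 ^ m" .
      then have "real (2 * m + 1) ^ 4 / real (d m) \<le> 81 ^ m / real (d m)"
        by (rule divide_right_mono) simp
      also have "81 ^ m / real (d m) = 1 / (real D * 2 ^ m)"
        unfolding dm by (rule nonzero_divide_mult_cancel_right, simp)
      finally show "real (2 * m + 1) ^ 4 / real (d m) \<le> 1 / (real D * 2 ^ m)" .
    qed (use \<delta> in auto)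
    also have "\<dots> = 24 / (\<delta> ^ 4 * real D * 2 ^ m) / real (d m)" by simp
    finally show ?thesis .
  qed
  have finI: "finite I" by (simp add: I_def)
  have "prob (\<Union>p\<in>I. V p) \<le> (\<Sum>p\<in>I. prob (V p))"
    using finI V by (intro finite_measure_subadditive_finite) auto
  also have "\<dots> = (\<Sum>m\<le>L. \<Sum>i<d m. prob (V (m, i)))"
    unfolding I_def by (subst sum.Sigma) auto
  also have "\<dots> \<le> (\<Sum>m\<le>L. \<Sum>i<d m. 24 / (\<delta> ^ 4 * real D * 2 ^ m) / real (d m))"
    by (intro sum_mono pV) auto
  also have "\<dots> = (\<Sum>m\<le>L. 24 / (\<delta> ^ 4 * real D) * (1 / 2) ^ m)"
    using dpos by (intro sum.cong) (auto simp: power_divide less_imp_neq)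
  also have "\<dots> = 24 / (\<delta> ^ 4 * real D) * (\<Sum>m\<le>L. (1 / 2) ^ m)"
    by (simp add: sum_distrib_left)
  also have "\<dots> \<le> 24 / (\<delta> ^ 4 * real D) * 2"
  proof (rule mult_left_mono)
    have "(\<Sum>m\<le>L. (1 / 2 :: real) ^ m) = 2 - (1 / 2) ^ L"
      by (induction L) (auto simp: field_simps)
    then show "(\<Sum>m\<le>L. (1 / 2 :: real) ^ m) \<le> 2" by simp
  qed (use \<delta> in auto)
  finally have pV': "prob (\<Union>p\<in>I. V p) \<le> 48 / (\<delta> ^ 4 * real D)" by simp
  define E where "E = U - (\<Union>p\<in>I. V p)"
  have "(\<Union>p\<in>I. V p) \<in> events" using finI V by auto
  then have E: "E \<in> events" and "prob U \<le> prob E + prob (\<Union>p\<in>I. V p)"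
    using U finite_measure_mono[of U "E \<union> (\<Union>p\<in>I. V p)"] measure_Un_le[of E M "\<Union>p\<in>I. V p"]
    by (force simp: E_def)+
  then have "(1 - \<delta>) / 2 - 48 / (\<delta> ^ 4 * real D) \<le> prob E"
    using pU pV' by linarith
  moreover have "\<delta> * sqrt (d L) < Re (\<Sum>j<d L. z j * \<xi> j \<omega>)" if "\<omega> \<in> E" for \<omega>
    using that by (simp add: E_def U_def)
  moreover have "norm (\<Sum>j | j < d L \<and> j mod d m = i. z j * \<xi> j \<omega>) \<le> \<delta> * sqrt (d L) / real (2 * m + 1)"
    if "\<omega> \<in> E" "m \<le> L" "i < d m" for \<omega> m i
  proof -
    have "(m, i) \<in> I" "\<omega> \<in> space M" "\<omega> \<notin> (\<Union>p\<in>I. V p)" using that by (auto simp: I_def E_def U_def)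
    then have "\<omega> \<notin> V (m, i)" by blast
    then show ?thesis using \<open>\<omega> \<in> space M\<close> by (simp add: V_def)
  qed
  ultimately show ?thesis using E by (intro bexI[of _ E]) auto
qed

text \<open>Some outcome \<omega> lies in the events of \<open>gaussian_event\<close> for at least
  the expected number of x, and these x form A. If x and x + s both belonged to A, the two Gaussian
  sums would add up to a real part above 2 * B, whereas \<open>twisted_sum_bound\<close> keeps the
  norm of their total below 2 * B.\<close>

lemma chunk:
  fixes d :: "nat \<Rightarrow> nat" and \<alpha> :: "nat \<Rightarrow> real"
  assumes D: "D > 0" and d: "\<And>m. d m = D * 162 ^ m" and \<delta>: "\<delta> > 0"
  shows "\<exists>A\<subseteq>{1..int N}. ((1 - \<delta>) / 2 - 48 / (\<delta> ^ 4 * real D)) * real N \<le> real (card A) \<and>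
    (\<forall>l s. l \<le> L \<longrightarrow>
      card {i. i < d l \<and> 1 / real (d l) < norm (1 + cis (2 * pi * (of_int s * \<alpha> i)))} \<le> l \<longrightarrow>
      (\<forall>m i. l \<le> m \<longrightarrow> d m \<le> i \<longrightarrow> i < d (Suc m) \<longrightarrow>
        norm (cis (2 * pi * (of_int s * \<alpha> i)) - cis (2 * pi * (of_int s * \<alpha> (i mod d m))))
          \<le> 1 / (2 ^ Suc m * real (d (Suc m)))) \<longrightarrow>
      s \<notin> difference_set A)"
proof -
  obtain M :: "(nat \<times> bool \<Rightarrow> real) measure" and \<xi>
    where M: "prob_space M" and \<xi>: "prob_space.complex_gaussian_family M (d L) \<xi>"
    using exists_complex_gaussian_family by blast
  interpret prob_space M by (rule M)
  define z where "z x j = cis (2 * pi * (of_int x * \<alpha> j))" for x :: int and j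
  have nz: "norm (z x j) = 1" for x j by (simp add: z_def)
  have z_add: "z (x + y) j = z x j * z y j" for x y j
    by (simp add: z_def cis_mult algebra_simps)
  define p where "p = (1 - \<delta>) / 2 - 48 / (\<delta> ^ 4 * real D)"
  define B where "B = \<delta> * sqrt (d L)"
  have dpos: "d m > 0" for m using D by (simp add: d)
  have B: "B > 0" using \<delta> dpos by (simp add: B_def)
  define good where "good x E \<longleftrightarrow> E \<in> events \<and> p \<le> prob E \<and>
    (\<forall>\<omega>\<in>E. B < Re (\<Sum>j<d L. z x j * \<xi> j \<omega>) \<and>
      (\<forall>m\<le>L. \<forall>i<d m. norm (\<Sum>j | j < d L \<and> j mod d m = i. z x j * \<xi> j \<omega>) \<le> B / real (2 * m + 1)))"
    for x E
  have "\<exists>E. good x E" for x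
    using gaussian_event[OF D d \<delta> \<xi> nz[of x]] unfolding good_def p_def B_def Bex_def .
  then obtain E where good: "\<And>x. good x (E x)" by metis
  have E: "\<And>x. E x \<in> events" "\<And>x. p \<le> prob (E x)"
    "\<And>x \<omega>. \<omega> \<in> E x \<Longrightarrow> B < Re (\<Sum>j<d L. z x j * \<xi> j \<omega>)"
    "\<And>x \<omega> m i. \<omega> \<in> E x \<Longrightarrow> m \<le> L \<Longrightarrow> i < d m \<Longrightarrow>
        norm (\<Sum>j | j < d L \<and> j mod d m = i. z x j * \<xi> j \<omega>) \<le> B / real (2 * m + 1)"
    using good unfolding good_def by simp_all
  have "p * real N = (\<Sum>x\<in>{1..int N}. p)" by simp
  also have "\<dots> \<le> (\<Sum>x\<in>{1..int N}. prob (E x))" by (intro sum_mono E(2))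
  finally obtain \<omega> where \<omega>: "p * real N \<le> real (card {x \<in> {1..int N}. \<omega> \<in> E x})"
    using exists_card_ge[of "{1..int N}" E] E(1) by blast
  define A where "A = {x \<in> {1..int N}. \<omega> \<in> E x}"
  have "s \<notin> difference_set A"
    if l: "l \<le> L" and flip: "card {i. i < d l \<and> 1 / real (d l) < norm (1 + z s i)} \<le> l"
      and close: "\<And>m i. l \<le> m \<Longrightarrow> d m \<le> i \<Longrightarrow> i < d (Suc m) \<Longrightarrow> norm (z s i - z s (i mod d m)) \<le> 1 / (2 ^ Suc m * real (d (Suc m)))"
    for l s
  proof
    assume "s \<in> difference_set A"
    then obtain x where x: "\<omega> \<in> E x" "\<omega> \<in> E (x + s)"
      by (force simp: difference_set_def A_def)
    \<comment> \<open>Here the multipliers v are \<open>z s\<close> and the weights w are the terms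
      of the Gaussian sum at x.\<close>
    have "norm (\<Sum>j<d L. (1 + z s j) * (z x j * \<xi> j \<omega>)) < 2 * B"
      using E(4)[OF x(1)] nz l flip close by (intro twisted_sum_bound[where d = d and l = l]) (auto simp: d D B)
    moreover have "(\<Sum>j<d L. (1 + z s j) * (z x j * \<xi> j \<omega>)) = (\<Sum>j<d L. z x j * \<xi> j \<omega>) + (\<Sum>j<d L. z (x + s) j * \<xi> j \<omega>)"
      by (simp add: z_add algebra_simps flip: sum.distrib)
    moreover have "2 * B < Re ((\<Sum>j<d L. z x j * \<xi> j \<omega>) + (\<Sum>j<d L. z (x + s) j * \<xi> j \<omega>))"
      using E(3)[OF x(1)] E(3)[OF x(2)] by simp
    ultimately show False using complex_Re_le_cmod by (metis less_asym less_le_trans not_less)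
  qed
  moreover have "A \<subseteq> {1..int N}" "p * real N \<le> real (card A)" using \<omega> by (auto simp: A_def)
  ultimately show ?thesis
    unfolding z_def p_def by (intro exI[of _ A]) simp
qed

theorem theorem1p2:
  fixes \<epsilon> :: real
  assumes "\<epsilon> > 0"
  shows "\<exists>(S :: int set) (A :: int set).
           bohr_topology closure_of S = topspace bohr_topology \<and>
           upper_banach_density A > ereal (1 / 2 - \<epsilon>) \<and>
           difference_set A \<inter> S = {}"
proof -
  \<comment> \<open>The losses from 1/2 are \<delta> / 2 = \<epsilon> / 4 and at most \<epsilon> / 4
    through the choice of D, together less than \<epsilon>.\<close>
  define \<delta> where "\<delta> = \<epsilon> / 2"
  have \<delta>: "\<delta> > 0" using assms by (simp add: \<delta>_def)
  obtain D :: nat where D0: "48 / (\<delta> ^ 4 * (\<epsilon> / 4)) < real D"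
    using reals_Archimedean2 by blast
  moreover have "0 < 48 / (\<delta> ^ 4 * (\<epsilon> / 4))" using \<delta> assms by simp
  ultimately have D: "D > 0" by (metis of_nat_0_less_iff less_trans)
  have Dsmall: "48 / (\<delta> ^ 4 * real D) \<le> \<epsilon> / 4"
  proof -
    have "48 < real D * (\<delta> ^ 4 * (\<epsilon> / 4))"
      using D0 \<delta> assms by (subst (asm) pos_divide_less_eq) auto
    then show ?thesis using \<delta> D by (subst pos_divide_le_eq) (auto simp: mult_ac)
  qed
  define d where "d m = D * 162 ^ m" for m :: nat
  have d_mono: "d l \<le> d (Suc l)" for l by (simp add: d_def)
  have d_gt: "l < d l" for l
  proof -
    have "l < 162 ^ l" by (rule power_gt_expt) simp
    also have "162 ^ l \<le> d l" using D by (simp add: d_def)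
    finally show ?thesis .
  qed
  from construction[of d, OF d_mono d_gt]
  obtain \<alpha> :: "nat \<Rightarrow> real" and S :: "nat \<Rightarrow> int set" and c :: "nat \<Rightarrow> int" where
    flip: "\<forall>l. \<forall>s\<in>S l. card {i. i < d l \<and> 1 / real (d l) < norm (1 + cis (2 * pi * (of_int s * \<alpha> i)))} \<le> l" and
    close: "\<forall>l m i. \<forall>s\<in>S l. l \<le> m \<longrightarrow> d m \<le> i \<longrightarrow> i < d (Suc m) \<longrightarrow>
       norm (cis (2 * pi * (of_int s * \<alpha> i)) - cis (2 * pi * (of_int s * \<alpha> (i mod d m))))
         \<le> 1 / (2 ^ Suc m * real (d (Suc m)))" and
    c: "\<forall>l. 0 \<le> c l \<and> c l + int l \<le> c (Suc l)" and
    S_large: "\<forall>l. \<forall>s\<in>S (Suc l). c l + int l < \<bar>s\<bar>" and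
    c_large: "\<forall>k l. k \<le> Suc l \<longrightarrow> (\<forall>s\<in>S k. c l + int l + \<bar>s\<bar> \<le> c (Suc l))" and
    dense: "\<forall>l t \<beta>. 0 < l \<longrightarrow> \<bar>t\<bar> \<le> int l \<longrightarrow> (\<exists>s\<in>S l. \<forall>i<l. near_int (1 / real (Suc l)) (of_int (s - t) * \<beta> i))"
    by (elim exE conjE)
  define p where "p = (1 - \<delta>) / 2 - 48 / (\<delta> ^ 4 * real D)"
  have p: "1 / 2 - \<epsilon> < p" using Dsmall assms by (simp add: p_def \<delta>_def diff_divide_distrib)
  have "\<exists>A\<subseteq>{1..int L}. p * real L \<le> real (card A) \<and> (\<forall>l\<le>L. \<forall>s\<in>S l. s \<notin> difference_set A)" for L
    using chunk[OF D d_def \<delta>, of L L \<alpha>] flip close unfolding p_def by meson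
  then obtain A where A: "\<And>L. A L \<subseteq> {1..int L}" "\<And>L. p * real L \<le> real (card (A L))"
    "\<And>L l s. l \<le> L \<Longrightarrow> s \<in> S l \<Longrightarrow> s \<notin> difference_set (A L)"
    by metis
  define S' where "S' = (\<Union>l. S l)"
  \<comment> \<open>The piece \<open>A L\<close> has length L and avoids only the sets S l with l
    \<le> L; the later sets are handled by the size of their elements.\<close>
  define A' where "A' = (\<Union>L. (\<lambda>x. c L + x) ` A L)"
  have end_mono: "c k + int k \<le> c l + int l" if "k \<le> l" for k l
    using that
  proof (induction l rule: dec_induct)
    case (step n)
    then show ?case using c[rule_format, of n] by linarith
  qed simp
  have S_large': "c k + int k < \<bar>s\<bar>" if "s \<in> S j" and kj: "k < j" for s j k
  proof -
    obtain l where "j = Suc l" using kj by (cases j) auto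
    then show ?thesis using S_large that end_mono[of k l] by force
  qed
  \<comment> \<open>For two different pieces: if j \<le> L, the gap before the later piece is
    already at least |s|; if j > L, then |s| exceeds the right end of the later piece. Absolute
    values cover both orders of subtraction.\<close>
  have cross: False if kL: "k < L" and x: "x \<in> A L" and y: "y \<in> A k" and s: "s \<in> S j"
      and eq: "\<bar>s\<bar> = \<bar>(c L + x) - (c k + y)\<bar>" for k L x y s j
  proof -
    obtain l where L: "L = Suc l" "k \<le> l" using kL by (cases L) auto
    have x: "1 \<le> x" "x \<le> int L" and y: "1 \<le> y" "y \<le> int k" using A(1) x y by force+
    have gap: "c L - (c l + int l) < c L + x - (c k + y)" using end_mono[OF L(2)] x y by linarith
    have nonneg: "0 \<le> c L - (c l + int l)" "0 \<le> c k" using c L(1) by (simp_all)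
    show False
    proof (cases "j \<le> L")
      case True
      then have "c l + int l + \<bar>s\<bar> \<le> c L" using c_large L(1) s by blast
      then show False using gap nonneg eq by linarith
    next
      case False
      then have "c L + int L < \<bar>s\<bar>" using S_large' s by simp
      then show False using gap nonneg eq x y by linarith
    qed
  qed
  have "difference_set A' \<inter> S' = {}"
  proof (rule ccontr)
    assume "difference_set A' \<inter> S' \<noteq> {}"
    then obtain L k x y j where s: "x \<in> A L" "y \<in> A k" "(c L + x) - (c k + y) \<in> S j"
      by (auto simp: difference_set_def A'_def S'_def)
    consider "k < L" | "L < k" | "k = L" by linarith
    then show False
    proof cases
      case 1
      then show False using cross s by blast
    next
      case 2
      then show False using cross[OF 2 s(2,1,3)] by linarith
    next
      case 3
      have "x - y \<in> difference_set (A L)" using s 3 by (auto simp: difference_set_def)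
      moreover have "x - y \<in> S j" using s(3) 3 by simp
      \<comment> \<open>Within one piece only sets with larger index remain, and their elements are
        longer than the piece.\<close>
      ultimately have "L < j" using A(3) not_less by blast
      then have "c L + int L < \<bar>x - y\<bar>" using S_large' \<open>x - y \<in> S j\<close> by blast
      moreover have "x \<in> {1..int L}" "y \<in> {1..int L}" using A(1) s 3 by blast+
      moreover have "0 \<le> c L" using c by blast
      ultimately show False by auto
    qed
  qed
  moreover have "upper_banach_density A' > ereal (1 / 2 - \<epsilon>)"
  proof -
    \<comment> \<open>The window of length n that starts after \<open>c n\<close> contains the whole
      n-th piece.\<close>
    have "ereal p \<le> (SUP k::int. ereal (real (card (A' \<inter> {k + 1..k + int n})) / real n))" if "n > 0" for n
    proof -
      have "p \<le> real (card (A n)) / real n" using A(2)[of n] that by (simp add: pos_le_divide_eq)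
      also have "card (A n) = card ((\<lambda>x. c n + x) ` A n)" by (simp add: card_image)
      also have "real (card ((\<lambda>x. c n + x) ` A n)) / real n \<le> real (card (A' \<inter> {c n + 1..c n + int n})) / real n"
        using A(1)[of n] by (intro divide_right_mono of_nat_mono card_mono) (auto simp: A'_def)
      finally have "ereal p \<le> ereal (real (card (A' \<inter> {c n + 1..c n + int n})) / real n)" by simp
      also have "\<dots> \<le> (SUP k::int. ereal (real (card (A' \<inter> {k + 1..k + int n})) / real n))"
        by (rule SUP_upper) simp
      finally show ?thesis .
    qed
    then have "ereal p \<le> upper_banach_density A'"
      unfolding upper_banach_density_def
      by (intro le_Limsup) (auto simp: eventually_at_top_linorder intro!: exI[of _ 1])
    then show ?thesis using p by (meson less_ereal.simps(1) less_le_trans)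
  qed
  moreover have "bohr_topology closure_of S' = topspace bohr_topology"
  proof -
    have "\<exists>s\<in>S'. s \<in> T" if "openin bohr_topology T" "t \<in> T" for T t
    proof -
      obtain B \<eta> where B: "finite B" "\<eta> > 0" "\<forall>n. (\<forall>b\<in>B. near_int \<eta> (of_int (n - t) * b)) \<longrightarrow> n \<in> T"
        using bohr_neighbourhood[OF \<open>openin bohr_topology T\<close> \<open>t \<in> T\<close>] by blast
      obtain \<beta> :: "nat \<Rightarrow> real" where \<beta>: "B = \<beta> ` {..<card B}"
        using ex_bij_betw_nat_finite[OF B(1)] by (metis atLeast0LessThan bij_betw_imp_surj_on)
      \<comment> \<open>Large enough for the number of frequencies, for the centre t and for the
        precision \<eta> at the same time.\<close>
      define l where "l = 1 + card B + nat \<bar>t\<bar> + nat \<lceil>1 / \<eta>\<rceil>"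
      have "1 / \<eta> \<le> real (Suc l)" unfolding l_def by linarith
      then have l: "1 / real (Suc l) \<le> \<eta>" using B(2) by (simp add: field_simps)
      have "0 < l" "\<bar>t\<bar> \<le> int l" by (simp_all add: l_def)
      then obtain s where s: "s \<in> S l" "\<forall>i<l. near_int (1 / real (Suc l)) (of_int (s - t) * \<beta> i)"
        using dense by blast
      have "near_int \<eta> (of_int (s - t) * b)" if b: "b \<in> B" for b
      proof -
        obtain i where "i < card B" "b = \<beta> i" using b \<beta> by blast
        then have "near_int (1 / real (Suc l)) (of_int (s - t) * b)" using s(2) by (simp add: l_def)
        then show ?thesis using l by (rule near_int_mono)
      qed
      then have "s \<in> T" using B(3) by blast
      then show ?thesis using s(1) by (auto simp: S'_def)
    qed
    then show ?thesis by (auto simp: closure_of_def)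
  qed
  ultimately show ?thesis by blast
qed

end
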